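(* Let $X$ be an M-embedded Banach space and let $Y\subseteq X$ be a closed nonreflexive subspace. Then $Y$ contains an asymptotic $c_0$-copy, that is, there is a sequence $(x_n)_{n\in\mathbb{N}}$ in $Y$ which spans $c_0$ asymptotically.
   Context: Banach spaces are over the complex field (the result also holds for real Banach spaces). A Banach space $X$ is regarded as a subspace of its bidual $X''$ via the canonical embedding. A projection $P$ on a Banach space $Z$ is an L-projection if $\|z\| = \|Pz\| + \|z-Pz\|$ for all $z\in Z$. A subspace $Y$ of a Banach space $Z$ is an M-ideal in $Z$ if its annihilator $Y^\bot$ in the dual $Z'$ is the range of an L-projection on $Z'$. A Banach space $X$ is M-embedded if $X$ is an M-ideal in $X''$. A sequence $(x_n)$ of nonzero elements of a Banach space spans $c_0$ asymptotically (isometrically) if there is a sequence $(\delta_n)$ in $[0,1)$ tending to $0$ such that $\sup_{n\le m}(1-\delta_n)|\alpha_n| \le \left\|\sum_{n=1}^m \alpha_n x_n\right\| \le \sup_{n\le m}(1+\delta_n)|\alpha_n|$ for all $m\in\mathbb{N}$ and all scalars $\alpha_1,\dots,\alpha_m$. *)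

theory Defs
  imports "HOL-Analysis.Analysis"
begin

section \<open>Complex normed spaces\<close>

text \<open>
  HOL-Analysis has type classes for real normed spaces only. A complex normed space is a real
  normed space with a multiplication by complex scalars that extends \<^const>\<open>scaleR\<close>, so
  that the topological and metric theory of real normed spaces stays applicable.
\<close>

class complex_vector = real_vector +
  fixes scaleC :: "complex \<Rightarrow> 'a \<Rightarrow> 'a" (infixr "*\<^sub>C" 75)
  assumes scaleC_add_right: "c *\<^sub>C (x + y) = c *\<^sub>C x + c *\<^sub>C y"
    and scaleC_add_left: "(c + d) *\<^sub>C x = c *\<^sub>C x + d *\<^sub>C x"
    and scaleC_scaleC: "c *\<^sub>C (d *\<^sub>C x) = (c * d) *\<^sub>C x"
    and scaleC_one: "1 *\<^sub>C x = x"
    and scaleR_scaleC: "r *\<^sub>R x = complex_of_real r *\<^sub>C x"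

class complex_normed_vector = complex_vector + real_normed_vector +
  assumes norm_scaleC: "norm (c *\<^sub>C x) = cmod c * norm x"

class cbanach = complex_normed_vector + complete_space

instance cbanach \<subseteq> banach ..

instantiation complex :: cbanach
begin

definition scaleC_complex :: "complex \<Rightarrow> complex \<Rightarrow> complex"
  where "c *\<^sub>C z = c * z" for c z :: complex

instance
  by standard (auto simp: scaleC_complex_def algebra_simps norm_mult scaleR_conv_of_real)

end

definition csubspace :: "'a::complex_vector set \<Rightarrow> bool" where
  "csubspace V \<longleftrightarrow>
     0 \<in> V \<and> (\<forall>x\<in>V. \<forall>y\<in>V. x + y \<in> V) \<and> (\<forall>c. \<forall>x\<in>V. c *\<^sub>C x \<in> V)"

definition bounded_clinear :: "('a::complex_normed_vector \<Rightarrow> 'b::complex_normed_vector) \<Rightarrow> bool" where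
  "bounded_clinear f \<longleftrightarrow> bounded_linear f \<and> (\<forall>c x. f (c *\<^sub>C x) = c *\<^sub>C f x)"

section \<open>The dual and bidual of a complex normed space\<close>

typedef (overloaded) 'a cdual = "{f :: 'a::complex_normed_vector \<Rightarrow> complex. bounded_clinear f}"
  morphisms cdual_apply Abs_cdual
  by (auto intro!: exI[of _ "\<lambda>_. 0"] simp: bounded_clinear_def scaleC_complex_def)

setup_lifting type_definition_cdual

instantiation cdual :: (complex_normed_vector) complex_normed_vector
begin

lift_definition zero_cdual :: "'a cdual" is "\<lambda>_. 0"
  by (auto simp: bounded_clinear_def scaleC_complex_def)

lift_definition plus_cdual :: "'a cdual \<Rightarrow> 'a cdual \<Rightarrow> 'a cdual" is "\<lambda>f g x. f x + g x"
  by (auto simp: bounded_clinear_def scaleC_complex_def bounded_linear_add algebra_simps)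

lift_definition uminus_cdual :: "'a cdual \<Rightarrow> 'a cdual" is "\<lambda>f x. - f x"
  by (auto simp: bounded_clinear_def scaleC_complex_def bounded_linear_minus)

lift_definition minus_cdual :: "'a cdual \<Rightarrow> 'a cdual \<Rightarrow> 'a cdual" is "\<lambda>f g x. f x - g x"
  by (auto simp: bounded_clinear_def scaleC_complex_def bounded_linear_sub algebra_simps)

lift_definition scaleR_cdual :: "real \<Rightarrow> 'a cdual \<Rightarrow> 'a cdual" is "\<lambda>r f x. r *\<^sub>R f x"
  by (auto simp: bounded_clinear_def scaleC_complex_def
        intro: bounded_linear_compose[OF bounded_linear_scaleR_right])

lift_definition scaleC_cdual :: "complex \<Rightarrow> 'a cdual \<Rightarrow> 'a cdual" is "\<lambda>c f x. c * f x"
  by (auto simp: bounded_clinear_def scaleC_complex_def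
        intro: bounded_linear_compose[OF bounded_linear_mult_right])

lift_definition norm_cdual :: "'a cdual \<Rightarrow> real" is onorm .

definition sgn_cdual :: "'a cdual \<Rightarrow> 'a cdual"
  where "sgn_cdual f = inverse (norm f) *\<^sub>R f"

definition dist_cdual :: "'a cdual \<Rightarrow> 'a cdual \<Rightarrow> real"
  where "dist_cdual f g = norm (f - g)"

definition uniformity_cdual :: "('a cdual \<times> 'a cdual) filter"
  where "uniformity_cdual = (INF e\<in>{0<..}. principal {(f, g). dist f g < e})"

definition open_cdual :: "'a cdual set \<Rightarrow> bool"
  where "open_cdual U = (\<forall>f\<in>U. \<forall>\<^sub>F (f', g) in uniformity. f' = f \<longrightarrow> g \<in> U)"

instance
proof
  fix f g h :: "'a cdual" and a b :: real and c d :: complex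
  show "f + g + h = f + (g + h)" by transfer (simp add: algebra_simps)
  show "f + g = g + f" by transfer (simp add: algebra_simps)
  show "0 + f = f" by transfer simp
  show "- f + f = 0" by transfer simp
  show "f - g = f + - g" by transfer simp
  show "a *\<^sub>R (f + g) = a *\<^sub>R f + a *\<^sub>R g" by transfer (simp add: algebra_simps)
  show "(a + b) *\<^sub>R f = a *\<^sub>R f + b *\<^sub>R f" by transfer (simp add: algebra_simps)
  show "a *\<^sub>R b *\<^sub>R f = (a * b) *\<^sub>R f" by transfer simp
  show "1 *\<^sub>R f = f" by transfer simp
  show "c *\<^sub>C (f + g) = c *\<^sub>C f + c *\<^sub>C g" by transfer (simp add: algebra_simps)
  show "(c + d) *\<^sub>C f = c *\<^sub>C f + d *\<^sub>C f" by transfer (simp add: algebra_simps)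
  show "c *\<^sub>C d *\<^sub>C f = (c * d) *\<^sub>C f" by transfer (simp add: mult.assoc)
  show "1 *\<^sub>C f = f" by transfer simp
  show "a *\<^sub>R f = complex_of_real a *\<^sub>C f" by transfer (simp add: scaleR_conv_of_real)
  show "dist f g = norm (f - g)" by (rule dist_cdual_def)
  show "sgn f = inverse (norm f) *\<^sub>R f" by (rule sgn_cdual_def)
  show "uniformity = (INF e\<in>{0<..}. principal {(f, g :: 'a cdual). dist f g < e})"
    by (rule uniformity_cdual_def)
  show "open U = (\<forall>f\<in>U. \<forall>\<^sub>F (f', g) in uniformity. f' = f \<longrightarrow> g \<in> U)" for U :: "'a cdual set"
    by (rule open_cdual_def)
  show "norm f = 0 \<longleftrightarrow> f = 0"
    by transfer (auto simp: bounded_clinear_def onorm_eq_0)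
  show "norm (f + g) \<le> norm f + norm g"
    by transfer (auto simp: bounded_clinear_def intro: onorm_triangle)
  show "norm (a *\<^sub>R f) = \<bar>a\<bar> * norm f"
    by transfer (auto simp: bounded_clinear_def onorm_scaleR)
  show "norm (c *\<^sub>C f) = cmod c * norm f"
  proof transfer
    fix c :: complex and f :: "'a \<Rightarrow> complex"
    assume "bounded_clinear f"
    then have f: "bounded_linear f" by (simp add: bounded_clinear_def)
    have "onorm (\<lambda>x. c * f x) = onorm (\<lambda>x. cmod c *\<^sub>R f x)"
      unfolding onorm_def by (simp add: norm_mult)
    then show "onorm (\<lambda>x. c * f x) = cmod c * onorm f"
      using onorm_scaleR[OF f, of "cmod c"] by simp
  qed
qed

end

lemma bounded_clinear_cdual_apply: "bounded_clinear (cdual_apply f)"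
  using cdual_apply[of f] by simp

lemma norm_cdual_apply: "cmod (cdual_apply f x) \<le> norm f * norm x"
  by transfer (auto simp: bounded_clinear_def intro: onorm)

instance cdual :: (complex_normed_vector) cbanach
proof
  fix X :: "nat \<Rightarrow> 'a cdual"
  assume X: "Cauchy X"
  define F where "F n = Blinfun (cdual_apply (X n))" for n
  have bl: "bounded_linear (cdual_apply f)" for f :: "'a cdual"
    using bounded_clinear_cdual_apply[of f] by (simp add: bounded_clinear_def)
  have F: "blinfun_apply (F n) = cdual_apply (X n)" for n
    unfolding F_def by (rule bounded_linear_Blinfun_apply[OF bl])
  have dist: "dist (X m) (X n) = dist (F m) (F n)" for m n
    unfolding dist_norm norm_blinfun.rep_eq norm_cdual.rep_eq
    by (simp add: F minus_blinfun.rep_eq minus_cdual.rep_eq)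
  have "Cauchy F"
    using X by (simp add: Cauchy_def dist)
  then obtain G where G: "F \<longlonglongrightarrow> G"
    by (auto simp: Cauchy_convergent_iff convergent_def)
  have lim: "(\<lambda>n. cdual_apply (X n) x) \<longlonglongrightarrow> blinfun_apply G x" for x
    using blinfun.tendsto[OF G tendsto_const[of x]] by (simp add: F)
  have "blinfun_apply G (c *\<^sub>C x) = c * blinfun_apply G x" for c x
  proof (rule LIMSEQ_unique[OF lim])
    show "(\<lambda>n. cdual_apply (X n) (c *\<^sub>C x)) \<longlonglongrightarrow> c * blinfun_apply G x"
      using tendsto_mult_left[OF lim[of x], of c] bounded_clinear_cdual_apply[of "X n" for n]
      by (simp add: bounded_clinear_def scaleC_complex_def)
  qed
  then have G': "bounded_clinear (blinfun_apply G)"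
    by (simp add: bounded_clinear_def scaleC_complex_def blinfun.bounded_linear_right)
  define L where "L = Abs_cdual (blinfun_apply G)"
  have L: "cdual_apply L = blinfun_apply G"
    using G' by (simp add: L_def Abs_cdual_inverse)
  have "dist (X n) L = dist (F n) G" for n
    unfolding dist_norm norm_blinfun.rep_eq norm_cdual.rep_eq
    by (simp add: F L minus_blinfun.rep_eq minus_cdual.rep_eq)
  then have "X \<longlonglongrightarrow> L"
    using G by (simp add: tendsto_dist_iff[of X] tendsto_dist_iff[of F])
  then show "convergent X"
    by (rule convergentI)
qed

lift_definition canonical_embedding :: "'a::complex_normed_vector \<Rightarrow> 'a cdual cdual"
  is "\<lambda>x f. cdual_apply f x"
proof -
  fix x :: 'a
  have "bounded_linear (\<lambda>f. cdual_apply f x)"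
    by (rule bounded_linear_intro[where K = "norm x"])
       (auto simp: plus_cdual.rep_eq scaleR_cdual.rep_eq intro: norm_cdual_apply)
  then show "bounded_clinear (\<lambda>f. cdual_apply f x)"
    by (simp add: bounded_clinear_def scaleC_cdual.rep_eq scaleC_complex_def)
qed

section \<open>M-ideals and M-embedded spaces\<close>

definition annihilator :: "'a::complex_normed_vector set \<Rightarrow> 'a cdual set" where
  "annihilator Y = {f. \<forall>y\<in>Y. cdual_apply f y = 0}"

definition L_projection :: "('a::complex_normed_vector \<Rightarrow> 'a) \<Rightarrow> bool" where
  "L_projection P \<longleftrightarrow>
     bounded_clinear P \<and> (\<forall>z. P (P z) = P z) \<and> (\<forall>z. norm z = norm (P z) + norm (z - P z))"

definition M_ideal :: "'a::complex_normed_vector set \<Rightarrow> bool" where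
  "M_ideal Y \<longleftrightarrow> csubspace Y \<and> (\<exists>P. L_projection P \<and> range P = annihilator Y)"

definition M_embedded :: "'a::cbanach itself \<Rightarrow> bool" where
  "M_embedded _ \<longleftrightarrow> M_ideal (range (canonical_embedding :: 'a \<Rightarrow> 'a cdual cdual))"

section \<open>Reflexive subspaces\<close>

text \<open>
  A subspace \<open>V\<close> is a set and not a type, so its dual and bidual are described here by functions
  on carriers: \<open>dual_on V\<close> consists of the bounded linear functionals on \<open>V\<close>, extended by
  \<open>0\<close> off \<open>V\<close> to make them unique as functions, with operator norm \<open>dual_norm V\<close>.
  The subspace is reflexive if the canonical map from \<open>V\<close> into \<open>bidual_on V\<close> is onto.
  Elements of \<open>bidual_on V\<close> only matter by their values on \<open>dual_on V\<close>.
\<close>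

definition dual_on :: "'a::complex_normed_vector set \<Rightarrow> ('a \<Rightarrow> complex) set" where
  "dual_on V = {f. (\<forall>x\<in>V. \<forall>y\<in>V. f (x + y) = f x + f y) \<and>
                   (\<forall>c. \<forall>x\<in>V. f (c *\<^sub>C x) = c * f x) \<and>
                   (\<exists>K. \<forall>x\<in>V. cmod (f x) \<le> K * norm x) \<and>
                   (\<forall>x. x \<notin> V \<longrightarrow> f x = 0)}"

definition dual_norm :: "'a::complex_normed_vector set \<Rightarrow> ('a \<Rightarrow> complex) \<Rightarrow> real" where
  "dual_norm V f = (SUP x\<in>V. cmod (f x) / norm x)"

definition bidual_on :: "'a::complex_normed_vector set \<Rightarrow> (('a \<Rightarrow> complex) \<Rightarrow> complex) set" where
  "bidual_on V = {\<Phi>. (\<forall>f\<in>dual_on V. \<forall>g\<in>dual_on V. \<Phi> (\<lambda>x. f x + g x) = \<Phi> f + \<Phi> g) \<and>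
                     (\<forall>c. \<forall>f\<in>dual_on V. \<Phi> (\<lambda>x. c * f x) = c * \<Phi> f) \<and>
                     (\<exists>K. \<forall>f\<in>dual_on V. cmod (\<Phi> f) \<le> K * dual_norm V f)}"

definition reflexive_subspace :: "'a::complex_normed_vector set \<Rightarrow> bool" where
  "reflexive_subspace V \<longleftrightarrow> (\<forall>\<Phi>\<in>bidual_on V. \<exists>v\<in>V. \<forall>f\<in>dual_on V. \<Phi> f = f v)"

lemma dual_on_UNIV: "dual_on UNIV = range (cdual_apply :: 'a::complex_normed_vector cdual \<Rightarrow> _)"
proof -
  have "f \<in> dual_on UNIV \<longleftrightarrow> bounded_clinear f" for f :: "'a \<Rightarrow> complex"
  proof
    assume "f \<in> dual_on UNIV"
    then obtain K where f: "\<And>x y. f (x + y) = f x + f y" "\<And>c x. f (c *\<^sub>C x) = c * f x"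
      and K: "\<And>x. cmod (f x) \<le> K * norm x"
      by (auto simp: dual_on_def)
    have "bounded_linear f"
      by (rule bounded_linear_intro[where K = K])
         (use f K in \<open>auto simp: scaleR_scaleC scaleC_complex_def scaleR_conv_of_real mult.commute\<close>)
    then show "bounded_clinear f"
      using f by (simp add: bounded_clinear_def scaleC_complex_def)
  next
    assume f: "bounded_clinear f"
    then have lin: "bounded_linear f" by (simp add: bounded_clinear_def)
    have "\<forall>x. cmod (f x) \<le> onorm f * norm x"
      using onorm[OF lin] by blast
    then show "f \<in> dual_on UNIV"
      using f linear_add[OF bounded_linear.linear[OF lin]]
      by (auto simp: dual_on_def bounded_clinear_def scaleC_complex_def)
  qed
  then show ?thesis
    using type_definition.Rep_range[OF type_definition_cdual] by blast
qed

text \<open>For the whole space this is surjectivity of \<^const>\<open>canonical_embedding\<close>.\<close>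

lemma reflexive_subspace_UNIV:
  "reflexive_subspace (UNIV :: 'a::complex_normed_vector set) \<longleftrightarrow>
     surj (canonical_embedding :: 'a \<Rightarrow> 'a cdual cdual)"
proof -
  let ?J = "canonical_embedding :: 'a \<Rightarrow> 'a cdual cdual"
  have nrm: "dual_norm UNIV (cdual_apply f) = norm f" for f :: "'a cdual"
    by (simp add: dual_norm_def norm_cdual.rep_eq onorm_def)
  have plus: "(\<lambda>x. cdual_apply f x + cdual_apply g x) = cdual_apply (f + g)" for f g :: "'a cdual"
    by (simp add: plus_cdual.rep_eq)
  have scale: "(\<lambda>x. c * cdual_apply f x) = cdual_apply (c *\<^sub>C f)" for c and f :: "'a cdual"
    by (simp add: scaleC_cdual.rep_eq)
  show ?thesis
  proof
    assume refl: "reflexive_subspace (UNIV :: 'a set)"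
    have "\<exists>v. F = ?J v" for F :: "'a cdual cdual"
    proof -
      define \<Phi> where "\<Phi> f = cdual_apply F (Abs_cdual f)" for f
      have \<Phi>: "\<Phi> (cdual_apply f) = cdual_apply F f" for f
        by (simp add: \<Phi>_def cdual_apply_inverse)
      have lin: "bounded_linear (cdual_apply F)"
        using bounded_clinear_cdual_apply[of F] by (simp add: bounded_clinear_def)
      have add: "cdual_apply F (f + g) = cdual_apply F f + cdual_apply F g" for f g
        by (rule linear_add[OF bounded_linear.linear[OF lin]])
      have sc: "cdual_apply F (c *\<^sub>C f) = c * cdual_apply F f" for c f
        using bounded_clinear_cdual_apply[of F] by (simp add: bounded_clinear_def scaleC_complex_def)
      have "\<Phi> \<in> bidual_on UNIV"
        using norm_cdual_apply[of F]
        by (auto simp: bidual_on_def dual_on_UNIV plus scale \<Phi> nrm add sc)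
      with refl obtain v where "\<And>f. cdual_apply F f = cdual_apply f v"
        by (auto simp: reflexive_subspace_def dual_on_UNIV \<Phi>)
      then have "F = ?J v"
        by (simp add: cdual_apply_inject[symmetric] canonical_embedding.rep_eq fun_eq_iff)
      then show ?thesis ..
    qed
    then show "surj ?J" by (auto simp: surj_def)
  next
    assume surj: "surj ?J"
    show "reflexive_subspace (UNIV :: 'a set)"
      unfolding reflexive_subspace_def
    proof
      fix \<Phi> assume "\<Phi> \<in> bidual_on (UNIV :: 'a set)"
      then obtain K where \<Phi>: "\<And>f g. \<Phi> (cdual_apply (f + g)) = \<Phi> (cdual_apply f) + \<Phi> (cdual_apply g)"
          "\<And>c f. \<Phi> (cdual_apply (c *\<^sub>C f)) = c * \<Phi> (cdual_apply f)"
        and K: "\<And>f :: 'a cdual. cmod (\<Phi> (cdual_apply f)) \<le> K * norm f"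
        by (auto simp: bidual_on_def dual_on_UNIV plus scale nrm)
      have "bounded_linear (\<lambda>f. \<Phi> (cdual_apply f))"
        by (rule bounded_linear_intro[where K = K])
           (use \<Phi> K in \<open>auto simp: scaleR_scaleC scaleC_complex_def mult.commute\<close>)
      then have cl: "bounded_clinear (\<lambda>f. \<Phi> (cdual_apply f))"
        using \<Phi> by (simp add: bounded_clinear_def scaleC_complex_def)
      obtain v where "?J v = Abs_cdual (\<lambda>f. \<Phi> (cdual_apply f))"
        using surj by (metis surj_def)
      then have "\<Phi> (cdual_apply f) = cdual_apply f v" for f
        using cl by (metis (no_types, lifting) Abs_cdual_inverse canonical_embedding.rep_eq mem_Collect_eq)
      then show "\<exists>v\<in>UNIV. \<forall>f\<in>dual_on UNIV. \<Phi> f = f v"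
        by (auto simp: dual_on_UNIV)
    qed
  qed
qed

section \<open>Asymptotic copies of \<open>c\<^sub>0\<close>\<close>

text \<open>Sequences are indexed from \<open>0\<close>.\<close>

definition spans_c0_asymptotically :: "(nat \<Rightarrow> 'a::complex_normed_vector) \<Rightarrow> bool" where
  "spans_c0_asymptotically x \<longleftrightarrow>
     (\<forall>n. x n \<noteq> 0) \<and>
     (\<exists>\<delta> :: nat \<Rightarrow> real. (\<forall>n. 0 \<le> \<delta> n \<and> \<delta> n < 1) \<and> \<delta> \<longlonglongrightarrow> 0 \<and>
        (\<forall>m. \<forall>\<alpha> :: nat \<Rightarrow> complex.
           (SUP n\<in>{..m}. (1 - \<delta> n) * cmod (\<alpha> n)) \<le> norm (\<Sum>n\<le>m. \<alpha> n *\<^sub>C x n) \<and>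
           norm (\<Sum>n\<le>m. \<alpha> n *\<^sub>C x n) \<le> (SUP n\<in>{..m}. (1 + \<delta> n) * cmod (\<alpha> n))))"

end

theory Submission
  imports Defs "HOL-Library.Function_Algebras"
begin

text \<open>
  Since \<open>Y\<close> is not reflexive, some \<open>z\<close> in the weak-star closure of \<open>Y\<close> in \<open>X''\<close> has distance \<open>1\<close>
  from \<open>X\<close>. M-embeddedness means \<open>X''' = X' \<oplus>\<^sub>1 X\<^sup>\<bottom>\<close>, and by the Hahn--Banach theorem this yields
  successive approximations \<open>y n\<close> of \<open>z\<close> in \<open>Y\<close> for which, in passing from \<open>v = x + a z\<close> with
  \<open>x \<in> X\<close> to \<open>v + c (z - y n)\<close>, the norm becomes at most \<open>max (norm v) \<bar>a + c\<bar>\<close>, up to a factor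
  close to \<open>1\<close>. Applied to
  \<open>\<alpha> 0 (y 1 - y 0) + \<dots> + \<alpha> (n - 1) (y n - y (n - 1)) + \<alpha> n (z - y n)\<close>, this bounds linear
  combinations of the differences \<open>x n = y (n + 1) - y n\<close> by the maximum of their coefficients, up
  to factors tending to \<open>1\<close>. The norms of the \<open>x n\<close> are eventually almost \<open>1\<close> or larger, because
  \<open>y (n + 1)\<close> is chosen to agree with \<open>z\<close> on a functional that nearly norms \<open>z - y n\<close>. The lower
  estimate follows from these two facts.
\<close>

section \<open>Sublinear functionals\<close>

definition sublinear :: "('a::real_vector \<Rightarrow> real) \<Rightarrow> bool" where
  "sublinear p \<longleftrightarrow>
     (\<forall>x y. p (x + y) \<le> p x + p y) \<and> (\<forall>c x. 0 \<le> c \<longrightarrow> p (c *\<^sub>R x) = c * p x)"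

lemma sublinear_add: "sublinear p \<Longrightarrow> p (x + y) \<le> p x + p y"
  by (simp add: sublinear_def)

lemma sublinear_scale: "sublinear p \<Longrightarrow> 0 \<le> c \<Longrightarrow> p (c *\<^sub>R x) = c * p x"
  by (simp add: sublinear_def)

lemma sublinear_0: "sublinear p \<Longrightarrow> p 0 = 0"
  using sublinear_scale[of p 0 0] by simp

lemma sublinear_uminus: "sublinear p \<Longrightarrow> - p (- x) \<le> p x"
  using sublinear_add[of p x "- x"] sublinear_0[of p] by simp

text \<open>An inequality is enough: applied to \<open>c *\<^sub>R x\<close> with the factor
  \<open>inverse c\<close>, it gives the reverse one.\<close>

lemma sublinearI:
  assumes add: "\<And>x y. p (x + y) \<le> p x + p y" and zero: "p 0 = 0"
    and scale: "\<And>c x. 0 < c \<Longrightarrow> p (c *\<^sub>R x) \<le> c * p x"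
  shows "sublinear p"
proof -
  have "p (c *\<^sub>R x) = c * p x" if "0 \<le> c" for c x
  proof (cases "c = 0")
    case False
    with that have c: "0 < c" by simp
    have "p (inverse c *\<^sub>R c *\<^sub>R x) \<le> inverse c * p (c *\<^sub>R x)"
      using c by (intro scale) simp
    with c have "c * p x \<le> p (c *\<^sub>R x)"
      by (simp add: field_simps)
    with scale[OF c, of x] show ?thesis by simp
  qed (simp add: zero)
  with add show ?thesis by (simp add: sublinear_def)
qed

text \<open>
  There is a linear functional that lies below \<open>p\<close> and above all points of such a cone. Rays, graphs
  of functionals on subspaces, and cones spanned by a point and a subspace give the usual forms of
  the Hahn--Banach theorem.
\<close>

definition hypocone :: "('a::real_vector \<Rightarrow> real) \<Rightarrow> ('a \<times> real) set \<Rightarrow> bool" where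
  "hypocone p K \<longleftrightarrow>
     0 \<in> K \<and> (\<forall>u\<in>K. \<forall>v\<in>K. u + v \<in> K) \<and> (\<forall>c>0. \<forall>u\<in>K. c *\<^sub>R u \<in> K) \<and>
     (\<forall>(w, b)\<in>K. b \<le> p w)"

text \<open>The infimum \<open>q x\<close> of \<open>p (x + w) - b\<close> over the cone is again
  sublinear, because the cone is closed under sums and positive multiples. It merges the two
  constraints into one: a linear \<open>F\<close> below \<open>q\<close> satisfies
  \<open>F x \<le> p x\<close> as well as \<open>- F w = F (- w) \<le> - b\<close> on the
  cone.\<close>

lemma sublinear_minorant_on_cone:
  assumes p: "sublinear p" and K: "hypocone p K"
  obtains q where "sublinear q" "\<And>x. q x \<le> p x" "\<And>w b. (w, b) \<in> K \<Longrightarrow> q (- w) \<le> - b"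
proof -
  have K0: "(0, 0) \<in> K"
    and Kadd: "\<And>w b w' b'. (w, b) \<in> K \<Longrightarrow> (w', b') \<in> K \<Longrightarrow> (w + w', b + b') \<in> K"
    and Ksc: "\<And>c w b. 0 < c \<Longrightarrow> (w, b) \<in> K \<Longrightarrow> (c *\<^sub>R w, c * b) \<in> K"
    and Kle: "\<And>w b. (w, b) \<in> K \<Longrightarrow> b \<le> p w"
    using K by (force simp: hypocone_def zero_prod_def)+
  define q where "q x = (INF u\<in>K. p (x + fst u) - snd u)" for x
  \<comment> \<open>This bound does not depend on \<open>(w, b)\<close>, so the infimum is
    finite.\<close>
  have lower: "- p (- x) \<le> p (x + w) - b" if "(w, b) \<in> K" for x w b
    using Kle[OF that] sublinear_add[OF p, of "x + w" "- x"] by simp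
  have bdd: "bdd_below ((\<lambda>u. p (x + fst u) - snd u) ` K)" for x
    by (rule bdd_belowI[of _ "- p (- x)"]) (use lower in auto)
  have q_le: "q x \<le> p (x + w) - b" if "(w, b) \<in> K" for x w b
    unfolding q_def using cINF_lower[OF bdd that, of x] by simp
  have q_ge: "r \<le> q x" if "\<And>w b. (w, b) \<in> K \<Longrightarrow> r \<le> p (x + w) - b" for r x
    unfolding q_def by (rule cINF_greatest) (use K0 that in auto)
  have "q (x + y) \<le> q x + q y" for x y
  proof -
    have "q (x + y) - q y \<le> p (x + w) - b" if u: "(w, b) \<in> K" for w b
    proof -
      have "q (x + y) - (p (x + w) - b) \<le> p (y + w') - b'" if v: "(w', b') \<in> K" for w' b'
        using q_le[OF Kadd[OF u v], of "x + y"] sublinear_add[OF p, of "x + w" "y + w'"]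
        by (simp add: algebra_simps)
      then show ?thesis
        using q_ge[of "q (x + y) - (p (x + w) - b)" y] by simp
    qed
    then show ?thesis
      using q_ge[of "q (x + y) - q y" x] by simp
  qed
  moreover have "q 0 = 0"
    using q_le[OF K0, of 0] q_ge[of 0 0] Kle sublinear_0[OF p] by force
  moreover have "q (c *\<^sub>R x) \<le> c * q x" if c: "0 < c" for c x
  proof -
    have "q (c *\<^sub>R x) / c \<le> p (x + w) - b" if u: "(w, b) \<in> K" for w b
      using q_le[OF Ksc[OF c u], of "c *\<^sub>R x"] sublinear_scale[OF p, of c "x + w"] c
      by (simp add: field_simps scaleR_right_distrib)
    then have "q (c *\<^sub>R x) / c \<le> q x"
      by (rule q_ge)
    then show ?thesis using c by (simp add: field_simps)
  qed
  ultimately have "sublinear q"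
    by (rule sublinearI)
  moreover have "q x \<le> p x" for x
    using q_le[OF K0, of x] by simp
  moreover have "q (- w) \<le> - b" if "(w, b) \<in> K" for w b
    using q_le[OF that, of "- w"] sublinear_0[OF p] by simp
  ultimately show thesis by (rule that)
qed

text \<open>A linear functional below \<open>p\<close> and above this ray takes the value
  \<open>p x\<close> at \<open>x\<close>.\<close>

lemma hypocone_ray:
  assumes p: "sublinear p"
  shows "hypocone p {(t *\<^sub>R x, t * p x) | t. 0 \<le> t}"
  unfolding hypocone_def
proof (intro conjI ballI allI impI)
  let ?K = "{(t *\<^sub>R x, t * p x) | t. 0 \<le> t}"
  show "0 \<in> ?K"
    by (auto simp: zero_prod_def intro: exI[of _ 0])
  show "u + v \<in> ?K" if "u \<in> ?K" "v \<in> ?K" for u v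
  proof -
    from that obtain s t where "u = (s *\<^sub>R x, s * p x)" "v = (t *\<^sub>R x, t * p x)" "0 \<le> s" "0 \<le> t"
      by blast
    then show ?thesis
      by (auto intro!: exI[of _ "s + t"] simp: algebra_simps)
  qed
  show "c *\<^sub>R u \<in> ?K" if "0 < c" "u \<in> ?K" for c u
  proof -
    from that obtain t where "u = (t *\<^sub>R x, t * p x)" "0 \<le> t" by blast
    with that show ?thesis by (auto intro!: exI[of _ "c * t"])
  qed
  show "case u of (w, b) \<Rightarrow> b \<le> p w" if "u \<in> ?K" for u
    using that by (auto simp: sublinear_scale[OF p])
qed

text \<open>Minimality forces the minorant built from the ray through \<open>(x, p x)\<close> to be
  \<open>p\<close> itself, whence \<open>p (- x) \<le> - p x\<close>. So \<open>p\<close> is odd,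
  and an odd sublinear functional is linear.\<close>

lemma minimal_sublinear_linear:
  assumes p: "sublinear p"
    and minimal: "\<And>q. sublinear q \<Longrightarrow> (\<And>x. q x \<le> p x) \<Longrightarrow> q = p"
  shows "linear p"
proof -
  have neg: "p (- x) = - p x" for x
  proof -
    obtain q where "sublinear q" "\<And>y. q y \<le> p y"
      and q: "\<And>w b. (w, b) \<in> {(t *\<^sub>R x, t * p x) | t. 0 \<le> t} \<Longrightarrow> q (- w) \<le> - b"
      by (rule sublinear_minorant_on_cone[OF p hypocone_ray[OF p, of x]]) blast
    then have "q = p" by (intro minimal)
    moreover have "q (- x) \<le> - p x"
      by (rule q) (auto intro: exI[of _ 1])
    ultimately show ?thesis
      using sublinear_uminus[OF p, of x] by simp
  qed
  show ?thesis
  proof (rule linearI)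
    fix x y
    show "p (x + y) = p x + p y"
      using sublinear_add[OF p, of x y] sublinear_add[OF p, of "- x" "- y"] neg[of "x + y"]
      by (simp add: neg)
  next
    fix c x
    show "p (c *\<^sub>R x) = c *\<^sub>R p x"
      using sublinear_scale[OF p, of c x] sublinear_scale[OF p, of "- c" x] neg[of "c *\<^sub>R x"]
      by (cases "0 \<le> c") auto
  qed
qed

text \<open>This supplies lower bounds of chains for Zorn's lemma. The common majorant
  \<open>q\<close> keeps the pointwise infimum finite, since \<open>- q (- x)\<close> bounds every
  \<open>p x\<close> from below.\<close>

lemma sublinear_chain_Inf:
  assumes ne: "C \<noteq> {}" and C: "\<And>p. p \<in> C \<Longrightarrow> sublinear p"
    and chain: "\<And>p q. p \<in> C \<Longrightarrow> q \<in> C \<Longrightarrow> p \<le> q \<or> q \<le> p"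
    and le: "\<And>p. p \<in> C \<Longrightarrow> p \<le> q"
  shows "sublinear (\<lambda>x. INF p\<in>C. p x)" and "p \<in> C \<Longrightarrow> (\<lambda>x. INF p\<in>C. p x) \<le> p"
proof -
  define u where "u x = (INF p\<in>C. p x)" for x
  have "- q (- x) \<le> p x" if "p \<in> C" for p x
    using sublinear_uminus[OF C[OF that], of x] le_funD[OF le[OF that], of "- x"] by linarith
  then have bdd: "bdd_below ((\<lambda>p. p x) ` C)" for x
    by (intro bdd_belowI[of _ "- q (- x)"]) auto
  have u_le: "u x \<le> p x" if "p \<in> C" for p x
    unfolding u_def by (rule cINF_lower[OF bdd that])
  have u_ge: "r \<le> u x" if "\<And>p. p \<in> C \<Longrightarrow> r \<le> p x" for r x
    unfolding u_def by (rule cINF_greatest) (use ne that in auto)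
  have "u (x + y) \<le> u x + u y" for x y
  proof -
    \<comment> \<open>Here \<open>q\<close> is another member of the chain. The smaller of the two,
      evaluated at \<open>x\<close> and at \<open>y\<close>, bounds the left side; this is where the
      chain condition enters.\<close>
    have pq: "u (x + y) \<le> p x + q y" if "p \<in> C" "q \<in> C" for p q
      using chain[OF that] u_le[OF that(1), of "x + y"] u_le[OF that(2), of "x + y"]
        sublinear_add[OF C[OF that(1)], of x y] sublinear_add[OF C[OF that(2)], of x y]
      by (force simp: le_fun_def dest: spec[of _ x] spec[of _ y])
    have "u (x + y) - u y \<le> p x" if "p \<in> C" for p
      using u_ge[of "u (x + y) - p x" y] pq[OF that] by (simp add: algebra_simps)
    then show ?thesis
      using u_ge[of "u (x + y) - u y" x] by simp
  qed
  moreover have "u 0 = 0"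
    using ne by (simp add: u_def sublinear_0[OF C])
  moreover have "u (c *\<^sub>R x) \<le> c * u x" if c: "0 < c" for c x
  proof -
    have "u (c *\<^sub>R x) / c \<le> p x" if "p \<in> C" for p
      using u_le[OF that, of "c *\<^sub>R x"] sublinear_scale[OF C[OF that], of c x] c
      by (simp add: field_simps)
    then have "u (c *\<^sub>R x) / c \<le> u x" by (rule u_ge)
    then show ?thesis using c by (simp add: field_simps)
  qed
  ultimately have "sublinear u" by (rule sublinearI)
  then show "sublinear (\<lambda>x. INF p\<in>C. p x)" by (simp add: u_def[abs_def])
  show "p \<in> C \<Longrightarrow> (\<lambda>x. INF p\<in>C. p x) \<le> p"
    using u_le by (simp add: u_def le_fun_def)
qed

lemma linear_minorant:
  assumes q: "sublinear q"
  obtains F where "linear F" "\<And>x. F x \<le> q x"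
proof -
  define A where "A = {p. sublinear p \<and> p \<le> q}"
  \<comment> \<open>Zorn's lemma is used with the order reversed, so that \<open>m\<close> is a
    minimal sublinear functional below \<open>q\<close>.\<close>
  have "\<exists>m\<in>A. \<forall>a\<in>A. m \<ge> a \<longrightarrow> a = m"
  proof (rule predicate_Zorn)
    show "partial_order_on A (relation_of (\<lambda>f g. f \<ge> g) A)"
      by (rule partial_order_on_relation_ofI) auto
  next
    fix C assume C: "C \<in> Chains (relation_of (\<lambda>f g. f \<ge> g) A)"
    show "\<exists>u\<in>A. \<forall>a\<in>C. a \<ge> u"
    proof (cases "C = {}")
      case True
      with q show ?thesis by (auto simp: A_def)
    next
      case False
      have CA: "C \<subseteq> A" and chain: "\<And>p r. p \<in> C \<Longrightarrow> r \<in> C \<Longrightarrow> p \<le> r \<or> r \<le> p"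
        using C by (auto simp: Chains_def relation_of_def)
      have sub: "\<And>p. p \<in> C \<Longrightarrow> sublinear p" and le: "\<And>p. p \<in> C \<Longrightarrow> p \<le> q"
        using CA by (auto simp: A_def)
      note I = sublinear_chain_Inf[OF False sub chain le]
      from False obtain p where "p \<in> C" by blast
      then have "(\<lambda>x. INF p\<in>C. p x) \<le> q"
        using I(2) le order_trans by blast
      with I show ?thesis by (intro bexI[of _ "\<lambda>x. INF p\<in>C. p x"]) (auto simp: A_def)
    qed
  qed
  then obtain m where m: "m \<in> A" "\<And>a. a \<in> A \<Longrightarrow> a \<le> m \<Longrightarrow> a = m" by blast
  have "linear m"
  proof (rule minimal_sublinear_linear)
    show "sublinear m" using m by (simp add: A_def)
    fix r assume "sublinear r" "\<And>x. r x \<le> m x"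
    then show "r = m"
      using m by (intro m(2)) (auto simp: A_def le_fun_def intro: order_trans)
  qed
  moreover have "m x \<le> q x" for x
    using m(1) by (simp add: A_def le_fun_def)
  ultimately show thesis by (rule that)
qed

section \<open>Forms of the Hahn--Banach theorem\<close>

lemma Hahn_Banach_cone:
  assumes "sublinear p" and "hypocone p K"
  obtains F where "linear F" "\<And>x. F x \<le> p x" "\<And>w b. (w, b) \<in> K \<Longrightarrow> b \<le> F w"
proof -
  obtain q where q: "sublinear q" "\<And>x. q x \<le> p x" "\<And>w b. (w, b) \<in> K \<Longrightarrow> q (- w) \<le> - b"
    by (rule sublinear_minorant_on_cone[OF assms]) blast
  obtain F where F: "linear F" "\<And>x. F x \<le> q x"
    by (rule linear_minorant[OF q(1)]) blast
  have ge: "b \<le> F w" if "(w, b) \<in> K" for w b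
    using order_trans[OF F(2) q(3)[OF that]] linear_neg[OF F(1), of w] by simp
  have le: "F x \<le> p x" for x
    using F(2)[of x] q(2)[of x] by linarith
  show thesis by (rule that[OF F(1) le ge])
qed

lemma Hahn_Banach_point:
  assumes "sublinear p"
  obtains F where "linear F" "\<And>x. F x \<le> p x" "F x = p x"
proof -
  obtain F where F: "linear F" "\<And>x. F x \<le> p x"
      "\<And>w b. (w, b) \<in> {(t *\<^sub>R x, t * p x) | t. 0 \<le> t} \<Longrightarrow> b \<le> F w"
    by (rule Hahn_Banach_cone[OF assms hypocone_ray[OF assms, of x]]) blast
  have "p x \<le> F x"
    by (rule F(3)) (auto intro: exI[of _ 1])
  then show thesis by (intro that[OF F(1,2)] antisym F(2))
qed

lemma Hahn_Banach_extension:
  assumes p: "sublinear p" and W: "subspace W"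
    and add: "\<And>x y. x \<in> W \<Longrightarrow> y \<in> W \<Longrightarrow> g (x + y) = g x + g y"
    and scale: "\<And>c x. x \<in> W \<Longrightarrow> g (c *\<^sub>R x) = c * g x"
    and le: "\<And>x. x \<in> W \<Longrightarrow> g x \<le> p x"
  obtains F where "linear F" "\<And>x. F x \<le> p x" "\<And>x. x \<in> W \<Longrightarrow> F x = g x"
proof -
  have g0: "g 0 = 0" using scale[of 0 0] subspace_0[OF W] by simp
  \<comment> \<open>The graph of \<open>g\<close> serves as the cone. It contains the points over
    \<open>x\<close> and over \<open>- x\<close>, and the two lower bounds give equality on
    \<open>W\<close>.\<close>
  have "hypocone p ((\<lambda>w. (w, g w)) ` W)"
    unfolding hypocone_def
    using W le by (auto simp: add scale zero_prod_def g0 image_iff subspace_def)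
  then obtain F where F: "linear F" "\<And>x. F x \<le> p x"
      "\<And>w b. (w, b) \<in> (\<lambda>w. (w, g w)) ` W \<Longrightarrow> b \<le> F w"
    by (rule Hahn_Banach_cone[OF p]) blast
  have eq: "F x = g x" if "x \<in> W" for x
  proof (rule antisym)
    show "g x \<le> F x" using that by (intro F(3)) auto
    have "g (- x) \<le> F (- x)" using that subspace_neg[OF W] by (intro F(3)) auto
    then show "F x \<le> g x"
      using scale[OF that, of "- 1"] linear_neg[OF F(1), of x] by simp
  qed
  show thesis by (rule that[OF F(1,2) eq])
qed

lemma Hahn_Banach_separation:
  assumes p: "sublinear p" and pos: "\<And>x. 0 \<le> p x" and W: "subspace W"
    and d: "\<And>w. w \<in> W \<Longrightarrow> d \<le> p (x + w)"
  obtains F where "linear F" "\<And>x. F x \<le> p x" "\<And>w. w \<in> W \<Longrightarrow> F w = 0" "d \<le> F x"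
proof -
  \<comment> \<open>This cone is spanned by the ray through \<open>(x, d)\<close> and by
    \<open>W\<close> at height \<open>0\<close>. Lying above it makes \<open>F\<close> at least
    \<open>d\<close> at \<open>x\<close> and nonnegative on the subspace \<open>W\<close>, hence
    zero there.\<close>
  define K where "K = {(t *\<^sub>R x + w, t * d) | t w. 0 \<le> t \<and> w \<in> W}"
  have "hypocone p K"
    unfolding hypocone_def
  proof (intro conjI ballI allI impI)
    show "0 \<in> K"
      unfolding K_def using subspace_0[OF W] by (auto simp: zero_prod_def intro!: exI[of _ 0])
  next
    fix u v assume "u \<in> K" "v \<in> K"
    then obtain s w t w' where "u = (s *\<^sub>R x + w, s * d)" "v = (t *\<^sub>R x + w', t * d)"
      "0 \<le> s" "0 \<le> t" "w \<in> W" "w' \<in> W"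
      by (auto simp: K_def)
    then show "u + v \<in> K"
      unfolding K_def using subspace_add[OF W]
      by (auto intro!: exI[of _ "s + t"] exI[of _ "w + w'"] simp: algebra_simps)
  next
    fix c :: real and u assume "0 < c" "u \<in> K"
    then obtain s w where "u = (s *\<^sub>R x + w, s * d)" "0 \<le> s" "w \<in> W"
      by (auto simp: K_def)
    then show "c *\<^sub>R u \<in> K"
      unfolding K_def using subspace_scale[OF W] \<open>0 < c\<close>
      by (auto intro!: exI[of _ "c * s"] exI[of _ "c *\<^sub>R w"] simp: algebra_simps)
  next
    fix u assume "u \<in> K"
    then obtain t w where u: "u = (t *\<^sub>R x + w, t * d)" and t: "0 \<le> t" and w: "w \<in> W"
      by (auto simp: K_def)
    have "t * d \<le> p (t *\<^sub>R x + w)"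
    proof (cases "t = 0")
      case False
      with t have "t * d \<le> t * p (x + inverse t *\<^sub>R w)"
        using d[OF subspace_scale[OF W w]] by (intro mult_left_mono)
      also have "\<dots> = p (t *\<^sub>R x + w)"
        using sublinear_scale[OF p t, of "x + inverse t *\<^sub>R w"] False
        by (simp add: scaleR_right_distrib)
      finally show ?thesis .
    qed (simp add: pos)
    then show "case u of (w, b) \<Rightarrow> b \<le> p w" by (simp add: u)
  qed
  then obtain F where F: "linear F" "\<And>x. F x \<le> p x" "\<And>w b. (w, b) \<in> K \<Longrightarrow> b \<le> F w"
    by (rule Hahn_Banach_cone[OF p]) blast
  have nonneg: "0 \<le> F w" if "w \<in> W" for w
    using that by (intro F(3)) (auto simp: K_def intro!: exI[of _ 0] exI[of _ w])
  have zero: "F w = 0" if "w \<in> W" for w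
    using nonneg[OF that] nonneg[OF subspace_neg[OF W that]] linear_neg[OF F(1), of w] by simp
  have dF: "d \<le> F x"
    by (rule F(3)) (use subspace_0[OF W] in \<open>force simp: K_def intro: exI[of _ 1]\<close>)
  show thesis by (rule that[OF F(1,2) zero dF])
qed

section \<open>Functionals on complex normed spaces\<close>

lemma cdual_bounded_linear: "bounded_linear (cdual_apply f)"
  using bounded_clinear_cdual_apply[of f] by (simp add: bounded_clinear_def)

lemma cdual_linear: "linear (cdual_apply f)"
  by (rule bounded_linear.linear[OF cdual_bounded_linear])

lemmas cdual_add = linear_add[OF cdual_linear]
  and cdual_diff = linear_diff[OF cdual_linear]
  and cdual_0 = linear_0[OF cdual_linear]
  and cdual_sum = linear_sum[OF cdual_linear]

lemma cdual_scaleC: "cdual_apply f (c *\<^sub>C x) = c * cdual_apply f x"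
  using bounded_clinear_cdual_apply[of f] by (simp add: bounded_clinear_def scaleC_complex_def)

lemma cdual_eqI: "(\<And>x. cdual_apply f x = cdual_apply g x) \<Longrightarrow> f = g"
  by (simp add: cdual_apply_inject[symmetric] fun_eq_iff)

lemma sum_cdual_apply: "cdual_apply (\<Sum>i\<in>I. f i) x = (\<Sum>i\<in>I. cdual_apply (f i) x)"
  by (induction I rule: infinite_finite_induct) (auto simp: zero_cdual.rep_eq plus_cdual.rep_eq)

lemma canonical_embedding_apply [simp]: "cdual_apply (canonical_embedding x) f = cdual_apply f x"
  by (simp add: canonical_embedding.rep_eq)

lemma canonical_embedding_add:
  "canonical_embedding (x + y) = canonical_embedding x + canonical_embedding y"
  by (rule cdual_eqI) (simp add: plus_cdual.rep_eq cdual_add)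

lemma canonical_embedding_diff:
  "canonical_embedding (x - y) = canonical_embedding x - canonical_embedding y"
  by (rule cdual_eqI) (simp add: minus_cdual.rep_eq cdual_diff)

lemma canonical_embedding_scaleC:
  "canonical_embedding (c *\<^sub>C x) = c *\<^sub>C canonical_embedding x"
  by (rule cdual_eqI) (simp add: scaleC_cdual.rep_eq cdual_scaleC)

lemma norm_cdual_leI:
  assumes "0 \<le> K" and "\<And>x. cmod (cdual_apply f x) \<le> K * norm x"
  shows "norm f \<le> K"
  unfolding norm_cdual.rep_eq by (rule onorm_bound) (use assms in auto)

text \<open>A unimodular factor turns \<open>f x\<close> into its modulus. Bounds on real parts,
  which are what the real Hahn--Banach theorem gives, are transferred to complex functionals in this
  way.\<close>

lemma cmod_le_by_rotation:
  assumes hom: "\<And>c. f (c *\<^sub>C x) = c * f x" and le: "\<And>c. cmod c = 1 \<Longrightarrow> Re (f (c *\<^sub>C x)) \<le> r"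
  shows "cmod (f x) \<le> r"
proof (cases "f x = 0")
  case True
  with hom le[of 1] show ?thesis by simp
next
  case False
  define c where "c = complex_of_real (cmod (f x)) / f x"
  have "c * f x = cmod (f x)" and "cmod c = 1"
    using False by (simp_all add: c_def norm_divide)
  then show ?thesis
    using le[of c] hom[of c] by simp
qed

lemma norm_cdual_leI_Re:
  assumes "0 \<le> K" and "\<And>x. Re (cdual_apply f x) \<le> K * norm x"
  shows "norm f \<le> K"
proof (rule norm_cdual_leI[OF assms(1)])
  fix x
  show "cmod (cdual_apply f x) \<le> K * norm x"
  proof (rule cmod_le_by_rotation[where f = "cdual_apply f"])
    show "cdual_apply f (c *\<^sub>C x) = c * cdual_apply f x" for c by (rule cdual_scaleC)
    show "Re (cdual_apply f (c *\<^sub>C x)) \<le> K * norm x" if "cmod c = 1" for c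
      using assms(2)[of "c *\<^sub>C x"] that by (simp add: norm_scaleC)
  qed
qed

lemma norm_cdual_approx:
  assumes "0 < e"
  obtains x where "norm x \<le> 1" "norm f - e \<le> Re (cdual_apply f x)"
proof -
  have "\<exists>x. norm x \<le> 1 \<and> norm f - e \<le> Re (cdual_apply f x)"
  proof (rule ccontr)
    assume "\<not> ?thesis"
    then have less: "Re (cdual_apply f x) < norm f - e" if "norm x \<le> 1" for x
      using that by force
    have "norm f \<le> norm f - e"
    proof (rule norm_cdual_leI_Re)
      show "0 \<le> norm f - e"
        using less[of 0] by (simp add: cdual_0)
      fix x
      show "Re (cdual_apply f x) \<le> (norm f - e) * norm x"
      proof (cases "x = 0")
        case False
        have "Re (cdual_apply f (inverse (norm x) *\<^sub>R x)) < norm f - e"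
          using False by (intro less) simp
        with False show ?thesis
          by (simp add: linear_scale[OF cdual_linear] field_simps)
      qed (simp add: cdual_0)
    qed
    with assms show False by simp
  qed
  with that show thesis by blast
qed

lemma complexify_functional:
  fixes F :: "'a::complex_normed_vector \<Rightarrow> real"
  assumes F: "linear F" and K: "0 \<le> K" and le: "\<And>x. F x \<le> K * norm x"
  obtains f where "\<And>x. Re (cdual_apply f x) = F x" "norm f \<le> K"
proof -
  \<comment> \<open>This is \<open>F x - \<i> * F (\<i> *\<^sub>C x)\<close>, the only complex
    linear functional with real part \<open>F\<close>.\<close>
  define f where "f x = Complex (F x) (- F (\<i> *\<^sub>C x))" for x
  have minus_one: "- 1 *\<^sub>C x = - x" for x :: 'a
    using scaleR_scaleC[of "- 1" x] by simp
  have add: "f (x + y) = f x + f y" for x y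
    by (simp add: f_def linear_add[OF F] scaleC_add_right complex_eq_iff)
  have split: "c *\<^sub>C x = Re c *\<^sub>R x + Im c *\<^sub>R (\<i> *\<^sub>C x)" for c and x :: 'a
    using complex_eq[of c] by (simp add: scaleR_scaleC scaleC_scaleC mult.commute flip: scaleC_add_left)
  have "\<i> *\<^sub>C c *\<^sub>C x = Re c *\<^sub>R (\<i> *\<^sub>C x) - Im c *\<^sub>R x" for c and x :: 'a
    using split[of c "\<i> *\<^sub>C x"] by (simp add: scaleC_scaleC minus_one mult.commute)
  then have F1: "F (\<i> *\<^sub>C c *\<^sub>C x) = Re c * F (\<i> *\<^sub>C x) - Im c * F x" for c x
    by (simp add: linear_diff[OF F] linear_scale[OF F])
  have F2: "F (c *\<^sub>C x) = Re c * F x + Im c * F (\<i> *\<^sub>C x)" for c x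
    using split[of c x] by (simp add: linear_add[OF F] linear_scale[OF F])
  have hom: "f (c *\<^sub>C x) = c * f x" for c x
    unfolding f_def F1[of c x] F2[of c x] by (simp add: complex_eq_iff)
  have bound: "cmod (f x) \<le> K * norm x" for x
  proof (rule cmod_le_by_rotation[OF hom])
    show "Re (f (c *\<^sub>C x)) \<le> K * norm x" if "cmod c = 1" for c
      using le[of "c *\<^sub>C x"] that by (simp add: f_def norm_scaleC)
  qed
  have "bounded_linear f"
    by (rule bounded_linear_intro[where K = K])
       (use bound in \<open>auto simp: add hom scaleR_scaleC scaleC_complex_def mult.commute\<close>)
  then have "bounded_clinear f"
    by (simp add: bounded_clinear_def hom scaleC_complex_def)
  then have app: "cdual_apply (Abs_cdual f) = f"
    by (simp add: Abs_cdual_inverse)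
  show thesis
  proof (rule that)
    show "Re (cdual_apply (Abs_cdual f) x) = F x" for x
      by (simp add: app f_def)
    show "norm (Abs_cdual f) \<le> K"
      by (rule norm_cdual_leI[OF K]) (simp add: app bound)
  qed
qed

lemma sublinear_norm: "0 \<le> K \<Longrightarrow> sublinear (\<lambda>x. K * norm x)"
  unfolding sublinear_def
  by (auto simp: mult_left_mono norm_triangle_ineq simp flip: distrib_left)

lemma csubspace_subspace: "csubspace V \<Longrightarrow> subspace V"
  by (auto simp: csubspace_def subspace_def scaleR_scaleC)

lemma csubspace_diff: "csubspace V \<Longrightarrow> x \<in> V \<Longrightarrow> y \<in> V \<Longrightarrow> x - y \<in> V"
  by (rule subspace_diff[OF csubspace_subspace])

lemma csubspace_scaleC: "csubspace V \<Longrightarrow> x \<in> V \<Longrightarrow> c *\<^sub>C x \<in> V"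
  by (simp add: csubspace_def)

lemma complex_eqI_Re_rotation:
  assumes "\<And>c. Re (c * a) = Re (c * b)"
  shows "a = b"
  using assms[of 1] assms[of \<i>] by (simp add: complex_eq_iff)

lemma cdual_extension:
  assumes V: "csubspace V" and g: "g \<in> dual_on V"
  obtains f where "\<And>x. x \<in> V \<Longrightarrow> cdual_apply f x = g x"
proof -
  have add: "\<And>x y. x \<in> V \<Longrightarrow> y \<in> V \<Longrightarrow> g (x + y) = g x + g y"
    and hom: "\<And>c x. x \<in> V \<Longrightarrow> g (c *\<^sub>C x) = c * g x"
    using g by (auto simp: dual_on_def)
  obtain K0 where K0: "\<And>x. x \<in> V \<Longrightarrow> cmod (g x) \<le> K0 * norm x"
    using g unfolding dual_on_def by blast
  \<comment> \<open>\<open>K0\<close> may be negative if \<open>V\<close> contains only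
    \<open>0\<close>, whereas \<open>sublinear_norm\<close> asks for a nonnegative factor.\<close>
  define K where "K = max 0 K0"
  have le: "cmod (g x) \<le> K * norm x" if "x \<in> V" for x
    using order_trans[OF K0[OF that] mult_right_mono[of K0 K "norm x"]] by (auto simp: K_def)
  have K: "0 \<le> K" by (simp add: K_def)
  obtain F where F: "linear F" "\<And>x. F x \<le> K * norm x" "\<And>x. x \<in> V \<Longrightarrow> F x = Re (g x)"
  proof (rule Hahn_Banach_extension[OF sublinear_norm[OF K] csubspace_subspace[OF V]])
    show "Re (g (x + y)) = Re (g x) + Re (g y)" if "x \<in> V" "y \<in> V" for x y
      using add[OF that] by simp
    show "Re (g (c *\<^sub>R x)) = c * Re (g x)" if "x \<in> V" for c x
      using hom[OF that] by (simp add: scaleR_scaleC)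
    show "Re (g x) \<le> K * norm x" if "x \<in> V" for x
      using le[OF that] complex_Re_le_cmod[of "g x"] by linarith
  qed blast
  obtain f where f: "\<And>x. Re (cdual_apply f x) = F x"
    by (rule complexify_functional[OF F(1) K F(2)]) blast
  have "cdual_apply f x = g x" if "x \<in> V" for x
  proof (rule complex_eqI_Re_rotation)
    show "Re (c * cdual_apply f x) = Re (c * g x)" for c
      using f[of "c *\<^sub>C x"] F(3)[OF csubspace_scaleC[OF V that], of c]
      by (simp add: cdual_scaleC hom[OF that])
  qed
  then show thesis by (rule that)
qed

lemma cdual_separation:
  assumes V: "csubspace V" and closed: "closed V" and x: "x \<notin> V"
  obtains f where "\<And>v. v \<in> V \<Longrightarrow> cdual_apply f v = 0" "cdual_apply f x \<noteq> 0"
proof -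
  obtain d where "0 < d" "ball x d \<subseteq> - V"
    using open_contains_ball[THEN iffD1, OF open_Compl[OF closed]] x by blast
  have d_le: "d \<le> dist x v" if "v \<in> V" for v
  proof (rule leI)
    show "\<not> dist x v < d"
      using \<open>ball x d \<subseteq> - V\<close> that by auto
  qed
  have p: "sublinear (norm :: 'a \<Rightarrow> real)"
    using sublinear_norm[of 1] by simp
  obtain F where F: "linear F" "\<And>y. F y \<le> norm y" "\<And>v. v \<in> V \<Longrightarrow> F v = 0" "d \<le> F x"
  proof (rule Hahn_Banach_separation[OF p _ csubspace_subspace[OF V]])
    show "d \<le> norm (x + w)" if "w \<in> V" for w
      using d_le[OF subspace_neg[OF csubspace_subspace[OF V] that]] by (simp add: dist_norm)
  qed (rule norm_ge_zero, blast)
  obtain f where f: "\<And>x. Re (cdual_apply f x) = F x"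
    by (rule complexify_functional[OF F(1), of 1]) (use F(2) in auto)
  have "cdual_apply f v = 0" if "v \<in> V" for v
  proof (rule complex_eqI_Re_rotation)
    show "Re (c * cdual_apply f v) = Re (c * 0)" for c
      using f[of "c *\<^sub>C v"] F(3)[OF csubspace_scaleC[OF V that], of c] by (simp add: cdual_scaleC)
  qed
  moreover have "cdual_apply f x \<noteq> 0"
    using f[of x] F(4) \<open>0 < d\<close> by auto
  ultimately show thesis by (rule that)
qed

lemma norm_canonical_embedding [simp]: "norm (canonical_embedding x) = norm x"
proof (rule antisym)
  show "norm (canonical_embedding x) \<le> norm x"
    using norm_cdual_apply[of _ x] by (intro norm_cdual_leI) (simp_all add: mult.commute)
  have "sublinear (norm :: 'a \<Rightarrow> real)"
    using sublinear_norm[of 1] by simp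
  then obtain F where F: "linear F" "\<And>y. F y \<le> norm y" "F x = norm x"
    by (rule Hahn_Banach_point) blast
  obtain f where f: "\<And>x. Re (cdual_apply f x) = F x" "norm f \<le> 1"
    by (rule complexify_functional[OF F(1), of 1]) (use F(2) in auto)
  have "norm x \<le> cmod (cdual_apply f x)"
    using f(1)[of x] F(3) complex_Re_le_cmod[of "cdual_apply f x"] by simp
  also have "\<dots> \<le> norm (canonical_embedding x) * norm f"
    using norm_cdual_apply[of "canonical_embedding x" f] by simp
  also have "\<dots> \<le> norm (canonical_embedding x) * 1"
    using f(2) by (intro mult_left_mono) auto
  finally show "norm x \<le> norm (canonical_embedding x)" by simp
qed

text \<open>The embedding is isometric, so completeness of X passes to the image. Closedness gives a
  point outside X a positive distance from X.\<close>

lemma closed_range_canonical_embedding: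
  "closed (range (canonical_embedding :: 'a::cbanach \<Rightarrow> 'a cdual cdual))"
proof -
  have "bounded_linear (canonical_embedding :: 'a \<Rightarrow> 'a cdual cdual)"
    by (rule bounded_linear_intro[where K = 1])
       (auto simp: canonical_embedding_add canonical_embedding_scaleC scaleR_scaleC)
  then have "complete (range (canonical_embedding :: 'a \<Rightarrow> 'a cdual cdual))"
    by (intro complete_isometric_image[where e = 1])
       (auto simp: subspace_UNIV complete_UNIV)
  then show ?thesis by (rule complete_imp_closed)
qed

section \<open>Approximation in M-embedded spaces\<close>

text \<open>Followed by the embedding of X' into X''', this restriction is the projection onto X'
  whose kernel is the annihilator of X. The L-projection given by M-embeddedness is compared with it
  below.\<close>

lift_definition restrict_bidual :: "'a::complex_normed_vector cdual cdual cdual \<Rightarrow> 'a cdual"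
  is "\<lambda>\<phi> x. cdual_apply \<phi> (canonical_embedding x)"
proof -
  fix \<phi> :: "'a cdual cdual cdual"
  have "bounded_linear (\<lambda>x. cdual_apply \<phi> (canonical_embedding x))"
    by (rule bounded_linear_intro[where K = "norm \<phi>"])
       (use norm_cdual_apply[of \<phi>] in \<open>auto simp: canonical_embedding_add canonical_embedding_scaleC
          cdual_add cdual_scaleC scaleR_scaleC scaleC_complex_def
          intro: order_trans[OF norm_cdual_apply]\<close>)
  then show "bounded_clinear (\<lambda>x. cdual_apply \<phi> (canonical_embedding x))"
    by (simp add: bounded_clinear_def canonical_embedding_scaleC cdual_scaleC scaleC_complex_def)
qed

text \<open>
  An L-projection \<open>P\<close> onto the annihilator of \<open>X\<close> kills \<open>X'\<close>: for \<open>f \<in> X'\<close>, the functional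
  \<open>f - P f\<close> has the same restriction to \<open>X\<close> as \<open>f\<close>, so that its norm is at least that of \<open>f\<close>.
\<close>

lemma M_embedded_norm_decomposition:
  fixes \<phi> :: "'a::cbanach cdual cdual cdual"
  assumes "M_embedded TYPE('a)"
  shows "norm \<phi> = norm (restrict_bidual \<phi>) + norm (\<phi> - canonical_embedding (restrict_bidual \<phi>))"
proof -
  let ?J = "canonical_embedding :: 'a \<Rightarrow> 'a cdual cdual"
  let ?f = "canonical_embedding (restrict_bidual \<phi>)"
  obtain P where P: "L_projection P" and range: "range P = annihilator (range ?J)"
    using assms by (auto simp: M_embedded_def M_ideal_def)
  have lin: "linear P" and idem: "\<And>\<psi>. P (P \<psi>) = P \<psi>"
    and norm: "\<And>\<psi>. norm \<psi> = norm (P \<psi>) + norm (\<psi> - P \<psi>)"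
    using P bounded_linear.linear[of P] unfolding L_projection_def bounded_clinear_def by blast+
  have "cdual_apply (P ?f) (?J x) = 0" for x
    using range rangeI[of P ?f] by (auto simp: annihilator_def)
  then have "norm (restrict_bidual \<phi>) \<le> norm (?f - P ?f)"
    using norm_cdual_apply[of "?f - P ?f" "?J x" for x]
    by (intro norm_cdual_leI) (auto simp: minus_cdual.rep_eq)
  then have "P ?f = 0"
    using norm[of ?f] by simp
  moreover have "P (\<phi> - ?f) = \<phi> - ?f"
  proof -
    have "\<phi> - ?f \<in> range P"
      unfolding range by (auto simp: annihilator_def minus_cdual.rep_eq restrict_bidual.rep_eq)
    then show ?thesis using idem by auto
  qed
  ultimately have "P \<phi> = \<phi> - ?f"
    by (simp add: linear_diff[OF lin])
  then show ?thesis using norm[of \<phi>] by simp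
qed

section \<open>Finite sums with the maximum norm and their duals\<close>

instantiation "fun" :: (type, real_vector) real_vector
begin

definition scaleR_fun :: "real \<Rightarrow> ('a \<Rightarrow> 'b) \<Rightarrow> 'a \<Rightarrow> 'b"
  where "scaleR_fun r f = (\<lambda>x. r *\<^sub>R f x)"

instance
  by standard (auto simp: scaleR_fun_def fun_eq_iff algebra_simps)

end

lemma sum_fun_apply: "(\<Sum>i\<in>I. f i) x = (\<Sum>i\<in>I. f i x)"
  by (induction I rule: infinite_finite_induct) auto

text \<open>The norm of a finite l-infinity sum. On all functions it is only a seminorm, as
  coordinates outside \<open>I\<close> are ignored. The inserted \<open>0\<close> covers empty
  \<open>I\<close>.\<close>

definition max_norm :: "'i set \<Rightarrow> ('i \<Rightarrow> 'a::real_normed_vector) \<Rightarrow> real" where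
  "max_norm I w = Max (insert 0 ((\<lambda>i. norm (w i)) ` I))"

lemma max_norm_nonneg: "finite I \<Longrightarrow> 0 \<le> max_norm I w"
  by (simp add: max_norm_def)

lemma norm_le_max_norm: "finite I \<Longrightarrow> i \<in> I \<Longrightarrow> norm (w i) \<le> max_norm I w"
  by (simp add: max_norm_def)

lemma max_norm_leI: "finite I \<Longrightarrow> 0 \<le> r \<Longrightarrow> (\<And>i. i \<in> I \<Longrightarrow> norm (w i) \<le> r) \<Longrightarrow> max_norm I w \<le> r"
  by (auto simp: max_norm_def)

lemma sublinear_max_norm:
  assumes I: "finite I"
  shows "sublinear (max_norm I :: ('i \<Rightarrow> 'a::real_normed_vector) \<Rightarrow> real)"
proof (rule sublinearI)
  fix v w :: "'i \<Rightarrow> 'a"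
  show "max_norm I (v + w) \<le> max_norm I v + max_norm I w"
  proof (rule max_norm_leI[OF I])
    show "norm ((v + w) i) \<le> max_norm I v + max_norm I w" if "i \<in> I" for i
      using norm_triangle_ineq[of "v i" "w i"] norm_le_max_norm[OF I that, of v]
        norm_le_max_norm[OF I that, of w] by simp
  qed (simp add: max_norm_nonneg[OF I])
next
  show "max_norm I (0 :: 'i \<Rightarrow> 'a) = 0"
    using max_norm_nonneg[OF I] by (intro antisym max_norm_leI[OF I]) auto
next
  fix c :: real and w :: "'i \<Rightarrow> 'a" assume "0 < c"
  then show "max_norm I (c *\<^sub>R w) \<le> c * max_norm I w"
    by (intro max_norm_leI[OF I])
       (auto simp: scaleR_fun_def max_norm_nonneg[OF I] intro!: mult_left_mono norm_le_max_norm[OF I])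
qed

text \<open>The dual of a finite l-infinity sum is the l-1 sum of the duals. The functional is
  complexified on each coordinate and then tested on a family of almost norming elements of the unit
  balls.\<close>

lemma dual_of_max_norm:
  fixes F :: "('i \<Rightarrow> 'a::complex_normed_vector) \<Rightarrow> real"
  assumes I: "finite I" and F: "linear F" and le: "\<And>w. F w \<le> max_norm I w"
  obtains \<phi> where "\<And>w. F w = (\<Sum>i\<in>I. Re (cdual_apply (\<phi> i) (w i)))" "(\<Sum>i\<in>I. norm (\<phi> i)) \<le> 1"
proof -
  define single where "single i u = (\<lambda>j. if j = i then u else 0)" for i :: 'i and u :: 'a
  have "\<exists>f. \<forall>u. Re (cdual_apply f u) = F (single i u)" for i
  proof -
    have "linear (single i)"
      by (rule linearI) (auto simp: single_def scaleR_fun_def)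
    then have "linear (\<lambda>u. F (single i u))"
      using linear_compose[OF _ F, of "single i"] by (simp add: o_def)
    moreover have "F (single i u) \<le> 1 * norm u" for u
      using order_trans[OF le[of "single i u"] max_norm_leI[OF I, of "norm u" "single i u"]]
      by (simp add: single_def)
    ultimately obtain f where "\<And>u. Re (cdual_apply f u) = F (single i u)"
      by (rule complexify_functional[OF _ zero_le_one]) blast
    then show ?thesis by blast
  qed
  then obtain \<phi> where \<phi>: "\<And>i u. Re (cdual_apply (\<phi> i) u) = F (single i u)"
    by metis
  have rep: "F w = (\<Sum>i\<in>I. Re (cdual_apply (\<phi> i) (w i)))" for w
  proof -
    define r where "r = (\<lambda>j. if j \<in> I then 0 else w j)"
    have "w j = ((\<Sum>i\<in>I. single i (w i)) + r) j" for j
      using I by (simp add: sum_fun_apply single_def r_def sum.delta' if_distrib cong: if_cong)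
    then have w: "w = (\<Sum>i\<in>I. single i (w i)) + r"
      by blast
    \<comment> \<open>\<open>r\<close> vanishes on \<open>I\<close>, so \<open>max_norm I\<close> is
      zero at \<open>r\<close> and at \<open>- r\<close>.\<close>
    have "F r \<le> 0" "F (- r) \<le> 0"
      using order_trans[OF le max_norm_leI[OF I order_refl]] by (auto simp: r_def)
    then have "F r = 0"
      using linear_neg[OF F, of r] by simp
    then show ?thesis
      by (subst w) (simp add: linear_add[OF F] linear_sum[OF F] \<phi>)
  qed
  have "(\<Sum>i\<in>I. norm (\<phi> i)) \<le> 1 + e" if "0 < e" for e
  proof -
    define \<epsilon> where "\<epsilon> = e / (real (card I) + 1)"
    have "0 < \<epsilon>" using that by (simp add: \<epsilon>_def)
    then have "\<exists>u. norm u \<le> 1 \<and> norm (\<phi> i) - \<epsilon> \<le> Re (cdual_apply (\<phi> i) u)" for i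
      using norm_cdual_approx[of \<epsilon> "\<phi> i"] by blast
    then obtain u where u: "\<And>i. norm (u i) \<le> 1" "\<And>i. norm (\<phi> i) - \<epsilon> \<le> Re (cdual_apply (\<phi> i) (u i))"
      by metis
    have "(\<Sum>i\<in>I. norm (\<phi> i) - \<epsilon>) \<le> F u"
      unfolding rep by (rule sum_mono) (rule u)
    also have "\<dots> \<le> 1"
      by (rule order_trans[OF le max_norm_leI[OF I]]) (simp_all add: u)
    finally have "(\<Sum>i\<in>I. norm (\<phi> i)) \<le> 1 + card I * \<epsilon>"
      by (simp add: sum_subtractf)
    also have "card I * \<epsilon> \<le> e"
      using that by (simp add: \<epsilon>_def field_simps)
    finally show ?thesis by simp
  qed
  then have "(\<Sum>i\<in>I. norm (\<phi> i)) \<le> 1"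
    by (rule field_le_epsilon)
  with rep show thesis by (rule that)
qed

text \<open>
  If no such \<open>y\<close> existed, a functional \<open>(\<phi> i)\<close> on a finite \<open>\<ell>\<^sub>\<infinity>\<close>-sum of copies of the bidual
  would separate. Splitting each \<open>\<phi> i\<close> into an element of \<open>X'\<close> and one of the annihilator of
  \<open>X\<close>, the former only sees \<open>v i\<close> and the latter only \<open>(a i + c i) z\<close>.
\<close>

lemma M_embedded_finite_approximation:
  fixes z :: "'a::cbanach cdual cdual" and Y :: "'a set"
  assumes M: "M_embedded TYPE('a)" and Y: "csubspace Y"
    and z: "\<And>f. (\<And>y. y \<in> Y \<Longrightarrow> cdual_apply f y = 0) \<Longrightarrow> cdual_apply z f = 0"
    and d: "\<And>\<psi>. (\<And>x. cdual_apply \<psi> (canonical_embedding x) = 0) \<Longrightarrow> cmod (cdual_apply \<psi> z) \<le> norm \<psi>"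
    and I: "finite I"
    and v: "\<And>i. i \<in> I \<Longrightarrow> v i - a i *\<^sub>C z \<in> range canonical_embedding"
      "\<And>i. i \<in> I \<Longrightarrow> norm (v i) \<le> R" "\<And>i. i \<in> I \<Longrightarrow> cmod (a i + c i) \<le> R"
    and R: "0 \<le> R" "R < R'"
  obtains y where "y \<in> Y" "\<And>i. i \<in> I \<Longrightarrow> norm (v i + c i *\<^sub>C (z - canonical_embedding y)) < R'"
proof -
  let ?J = "canonical_embedding :: 'a \<Rightarrow> 'a cdual cdual"
  have "\<exists>y\<in>Y. \<forall>i\<in>I. norm (v i + c i *\<^sub>C (z - ?J y)) < R'"
  proof (rule ccontr)
    assume "\<not> ?thesis"
    then have far: "\<exists>i\<in>I. R' \<le> norm (v i + c i *\<^sub>C (z - ?J y))" if "y \<in> Y" for y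
      using that by force
    \<comment> \<open>Letting \<open>y\<close> run through \<open>Y\<close> moves the point
      \<open>pt\<close> along the image of \<open>Y\<close> under \<open>T\<close>. By assumption
      this affine subspace stays at distance at least \<open>R'\<close> from the origin, so some
      \<open>F\<close> vanishes on the directions and is at least \<open>R'\<close> at
      \<open>pt\<close>.\<close>
    define T where "T y = (\<lambda>i. c i *\<^sub>C ?J y)" for y
    define pt where "pt = (\<lambda>i. v i + c i *\<^sub>C z)"
    have "linear T"
      by (rule linearI)
         (auto simp: T_def scaleR_fun_def canonical_embedding_add scaleC_add_right scaleR_scaleC
           canonical_embedding_scaleC scaleC_scaleC mult.commute)
    then have W: "subspace (T ` Y)"
      by (rule linear_subspace_image) (rule csubspace_subspace[OF Y])
    have "R' \<le> max_norm I (pt + w)" if "w \<in> T ` Y" for w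
    proof -
      from that obtain y where y: "y \<in> Y" "w = T y" by blast
      from far[OF subspace_neg[OF csubspace_subspace[OF Y] y(1)]]
      obtain i where i: "i \<in> I" "R' \<le> norm (v i + c i *\<^sub>C (z - ?J (- y)))" by blast
      have "z - ?J (- y) = z + ?J y"
        using canonical_embedding_diff[of 0 y] canonical_embedding_diff[of 0 0] by simp
      with i(2) have "R' \<le> norm ((pt + w) i)"
        by (simp add: y pt_def T_def scaleC_add_right add.assoc)
      then show ?thesis
        using norm_le_max_norm[OF I i(1)] by (rule order_trans)
    qed
    then obtain F where F: "linear F" "\<And>w. F w \<le> max_norm I w" "\<And>w. w \<in> T ` Y \<Longrightarrow> F w = 0"
      "R' \<le> F pt"
      by (rule Hahn_Banach_separation[OF sublinear_max_norm[OF I] max_norm_nonneg[OF I] W]) (assumption, rule that)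
    obtain \<phi> where \<phi>: "\<And>w. F w = (\<Sum>i\<in>I. Re (cdual_apply (\<phi> i) (w i)))"
      and norm_\<phi>: "(\<Sum>i\<in>I. norm (\<phi> i)) \<le> 1"
      by (rule dual_of_max_norm[OF I F(1,2)]) blast
    define f where "f i = restrict_bidual (\<phi> i)" for i
    define \<psi> where "\<psi> i = \<phi> i - canonical_embedding (f i)" for i
    have \<phi>_split: "cdual_apply (\<phi> i) u = cdual_apply u (f i) + cdual_apply (\<psi> i) u" for i u
      by (simp add: \<psi>_def minus_cdual.rep_eq)
    have \<psi>_J: "cdual_apply (\<psi> i) (?J x) = 0" for i x
      by (simp add: \<psi>_def f_def minus_cdual.rep_eq restrict_bidual.rep_eq)
    \<comment> \<open>\<open>F\<close> vanishes on the image of \<open>T\<close>, so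
      \<open>h\<close> vanishes on \<open>Y\<close>. By the hypothesis on \<open>z\<close> the terms
      \<open>c i * cdual_apply z (f i)\<close> then cancel in \<open>F pt\<close>.\<close>
    define h where "h = (\<Sum>i\<in>I. c i *\<^sub>C f i)"
    have "cdual_apply h y = 0" if y: "y \<in> Y" for y
    proof (rule complex_eqI_Re_rotation)
      fix b
      have "b * cdual_apply h y = (\<Sum>i\<in>I. cdual_apply (\<phi> i) (T (b *\<^sub>C y) i))"
        by (simp add: T_def h_def f_def sum_cdual_apply scaleC_cdual.rep_eq restrict_bidual.rep_eq
            cdual_scaleC canonical_embedding_scaleC sum_distrib_left mult.left_commute)
      then have "Re (b * cdual_apply h y) = F (T (b *\<^sub>C y))"
        by (simp only: \<phi> Re_sum)
      also have "\<dots> = 0"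
        using csubspace_scaleC[OF Y y] by (intro F(3)) blast
      finally show "Re (b * cdual_apply h y) = Re (b * 0)" by simp
    qed
    then have "cdual_apply z h = 0"
      by (rule z)
    then have zh: "(\<Sum>i\<in>I. c i * cdual_apply z (f i)) = 0"
      by (simp add: h_def cdual_sum cdual_scaleC)
    have \<psi>_v: "cdual_apply (\<psi> i) (v i) = a i * cdual_apply (\<psi> i) z" if "i \<in> I" for i
    proof -
      from v(1)[OF that] obtain x where "v i = ?J x + a i *\<^sub>C z"
        by (auto simp: algebra_simps)
      then show ?thesis by (simp add: cdual_add cdual_scaleC \<psi>_J)
    qed
    have "F pt = Re (\<Sum>i\<in>I. cdual_apply (\<phi> i) (pt i))"
      by (simp add: \<phi>)
    also have "(\<Sum>i\<in>I. cdual_apply (\<phi> i) (pt i)) =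
        (\<Sum>i\<in>I. cdual_apply (v i) (f i) + (a i + c i) * cdual_apply (\<psi> i) z)
        + (\<Sum>i\<in>I. c i * cdual_apply z (f i))"
      unfolding sum.distrib[symmetric]
      by (rule sum.cong)
         (simp_all add: pt_def cdual_add cdual_scaleC \<phi>_split \<psi>_v algebra_simps)
    also have "Re \<dots> = (\<Sum>i\<in>I. Re (cdual_apply (v i) (f i) + (a i + c i) * cdual_apply (\<psi> i) z))"
      by (simp add: zh)
    \<comment> \<open>The two parts of each summand are bounded by \<open>R * norm (f i)\<close> and
      \<open>R * norm (\<psi> i)\<close>. These add up to exactly
      \<open>R * norm (\<phi> i)\<close>, because X''' is the l-1 sum of X' and the annihilator of
      X.\<close>
    also have "\<dots> \<le> (\<Sum>i\<in>I. R * norm (\<phi> i))"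
    proof (rule sum_mono)
      fix i assume i: "i \<in> I"
      have "cmod (cdual_apply (v i) (f i)) \<le> R * norm (f i)"
        using norm_cdual_apply[of "v i" "f i"] mult_right_mono[OF v(2)[OF i], of "norm (f i)"]
        by simp
      moreover have "cmod ((a i + c i) * cdual_apply (\<psi> i) z) \<le> R * norm (\<psi> i)"
        unfolding norm_mult using v(3)[OF i] d[OF \<psi>_J] R(1) by (intro mult_mono) auto
      moreover have "norm (\<phi> i) = norm (f i) + norm (\<psi> i)"
        unfolding f_def \<psi>_def by (rule M_embedded_norm_decomposition[OF M])
      ultimately show "Re (cdual_apply (v i) (f i) + (a i + c i) * cdual_apply (\<psi> i) z)
          \<le> R * norm (\<phi> i)"
        using complex_Re_le_cmod[of "cdual_apply (v i) (f i) + (a i + c i) * cdual_apply (\<psi> i) z"]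
          norm_triangle_ineq[of "cdual_apply (v i) (f i)" "(a i + c i) * cdual_apply (\<psi> i) z"]
        by (simp add: distrib_left)
    qed
    also have "\<dots> \<le> R * 1"
      unfolding sum_distrib_left[symmetric] using norm_\<phi> R(1) by (rule mult_left_mono)
    finally show False using F(4) R(2) by simp
  qed
  with that show thesis by blast
qed

text \<open>A finite net of \<open>K\<close> reduces this to the finite case. Passing from the net
  to all of \<open>K\<close> requires a bound on \<open>z - y\<close>, which is obtained by adding
  one more triple to the net.\<close>

lemma M_embedded_compact_approximation:
  fixes z :: "'a::cbanach cdual cdual" and Y :: "'a set"
  assumes M: "M_embedded TYPE('a)" and Y: "csubspace Y"
    and z: "\<And>f. (\<And>y. y \<in> Y \<Longrightarrow> cdual_apply f y = 0) \<Longrightarrow> cdual_apply z f = 0"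
    and d: "\<And>\<psi>. (\<And>x. cdual_apply \<psi> (canonical_embedding x) = 0) \<Longrightarrow> cmod (cdual_apply \<psi> z) \<le> norm \<psi>"
    and K: "compact K"
    and v: "\<And>v a c. (v, a, c) \<in> K \<Longrightarrow> v - a *\<^sub>C z \<in> range canonical_embedding"
      "\<And>v a c. (v, a, c) \<in> K \<Longrightarrow> norm v \<le> R" "\<And>v a c. (v, a, c) \<in> K \<Longrightarrow> cmod (a + c) \<le> R"
    and R: "0 < R" "R < R'"
  obtains y where "y \<in> Y"
    "\<And>v a c. (v, a, c) \<in> K \<Longrightarrow> norm (v + c *\<^sub>C (z - canonical_embedding y)) \<le> R'"
proof -
  let ?J = "canonical_embedding :: 'a \<Rightarrow> 'a cdual cdual"
  define r where "r = (R + R') / 2"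
  have r: "R < r" "r < R'" "0 < r" using R by (auto simp: r_def)
  \<comment> \<open>The mesh \<open>e\<close> solves \<open>r + e + e * (r / R) = R'\<close>; the
    three terms account for the value at a net point, the change of \<open>v\<close> and the change
    of \<open>c\<close>.\<close>
  define e where "e = (R' - r) / (1 + r / R)"
  have e: "0 < e" "e * (1 + r / R) = R' - r"
    using r R add_pos_pos[of 1 "r / R"] by (auto simp: e_def)
  obtain K0 where K0: "K0 \<subseteq> K" "finite K0" "K \<subseteq> (\<Union>k\<in>K0. ball k e)"
    by (rule compactE_image[OF K, of K "\<lambda>k. ball k e"]) (use e in auto)
  \<comment> \<open>The added triple meets the hypotheses, and its estimate reads
    \<open>R * norm (z - ?J y) < r\<close>.\<close>
  define I where "I = insert (0, 0, complex_of_real R) K0"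
  have "0 = ?J 0"
    using canonical_embedding_diff[of 0 "0::'a"] by simp
  then have J0: "0 \<in> range ?J" by blast
  have scale0: "0 *\<^sub>C u = 0" for u :: "'a cdual cdual"
    using scaleR_scaleC[of 0 u] by simp
  obtain y where y: "y \<in> Y"
    and small: "\<And>k. k \<in> I \<Longrightarrow> norm (fst k + snd (snd k) *\<^sub>C (z - ?J y)) < r"
  proof (rule M_embedded_finite_approximation[OF M Y z d])
    show "finite I" using K0 by (simp add: I_def)
    show "fst k - fst (snd k) *\<^sub>C z \<in> range ?J" "norm (fst k) \<le> R"
        "cmod (fst (snd k) + snd (snd k)) \<le> R" if "k \<in> I" for k
    proof -
      from that consider "k = (0, 0, complex_of_real R)" | v0 a0 c0 where "k = (v0, a0, c0)" "k \<in> K"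
        using K0(1) by (cases k) (auto simp: I_def)
      then show "fst k - fst (snd k) *\<^sub>C z \<in> range ?J" "norm (fst k) \<le> R"
          "cmod (fst (snd k) + snd (snd k)) \<le> R"
        using v[of "fst k" "fst (snd k)" "snd (snd k)"] R J0 by (cases; simp add: scale0)+
    qed
    show "0 \<le> R" "R < r" using R r by auto
  qed blast+
  have "R * norm (z - ?J y) < r"
    using small[of "(0, 0, complex_of_real R)"] R by (simp add: I_def norm_scaleC)
  then have bound: "norm (z - ?J y) \<le> r / R"
    using R by (simp add: field_simps)
  have "norm (v + c *\<^sub>C (z - ?J y)) \<le> R'" if "(v, a, c) \<in> K" for v a c
  proof -
    from K0(3) that have "(v, a, c) \<in> (\<Union>k\<in>K0. ball k e)" by (rule subsetD)
    then obtain v0 a0 c0 where k: "(v0, a0, c0) \<in> K0" "dist (v0, a0, c0) (v, a, c) < e"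
      by (auto simp del: dist_Pair_Pair)
    have dv: "norm (v - v0) \<le> e" and dc: "cmod (c - c0) \<le> e"
      using k(2) dist_fst_le[of "(v0, a0, c0)" "(v, a, c)"]
        dist_snd_le[of "(v0, a0, c0)" "(v, a, c)"] dist_snd_le[of "(a0, c0)" "(a, c)"]
      by (auto simp: dist_norm norm_minus_commute)
    have "c *\<^sub>C (z - ?J y) = c0 *\<^sub>C (z - ?J y) + (c - c0) *\<^sub>C (z - ?J y)"
      by (simp flip: scaleC_add_left)
    then have "v + c *\<^sub>C (z - ?J y) =
        (v0 + c0 *\<^sub>C (z - ?J y)) + ((v - v0) + (c - c0) *\<^sub>C (z - ?J y))"
      by simp
    also have "norm \<dots> \<le> norm (v0 + c0 *\<^sub>C (z - ?J y)) + (norm (v - v0) + norm ((c - c0) *\<^sub>C (z - ?J y)))"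
      by (intro norm_triangle_le add_left_mono norm_triangle_ineq)
    also have "norm ((c - c0) *\<^sub>C (z - ?J y)) \<le> e * (r / R)"
      unfolding norm_scaleC using dc bound e(1) by (intro mult_mono) auto
    also have "norm (v0 + c0 *\<^sub>C (z - ?J y)) \<le> r"
      using small[of "(v0, a0, c0)"] k(1) by (simp add: I_def)
    finally show ?thesis using dv e(2) by (simp add: algebra_simps)
  qed
  with y show thesis by (rule that)
qed

text \<open>The unconstrained lemma is applied to the kernel of \<open>f\<close> in \<open>Y\<close>
  and to \<open>z - y1\<close>, where \<open>y1\<close> in \<open>Y\<close> satisfies the
  constraint. Translating \<open>z\<close> by an element of X affects neither the membership of
  \<open>v - a z\<close> in X nor the values of functionals that vanish on X.\<close>

lemma M_embedded_compact_approximation_constrained: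
  fixes z :: "'a::cbanach cdual cdual" and Y :: "'a set"
  assumes M: "M_embedded TYPE('a)" and Y: "csubspace Y"
    and z: "\<And>f. (\<And>y. y \<in> Y \<Longrightarrow> cdual_apply f y = 0) \<Longrightarrow> cdual_apply z f = 0"
    and d: "\<And>\<psi>. (\<And>x. cdual_apply \<psi> (canonical_embedding x) = 0) \<Longrightarrow> cmod (cdual_apply \<psi> z) \<le> norm \<psi>"
    and K: "compact K"
    and v: "\<And>v a c. (v, a, c) \<in> K \<Longrightarrow> v - a *\<^sub>C z \<in> range canonical_embedding"
      "\<And>v a c. (v, a, c) \<in> K \<Longrightarrow> norm v \<le> R" "\<And>v a c. (v, a, c) \<in> K \<Longrightarrow> cmod (a + c) \<le> R"
    and R: "0 < R" "R < R'"
  obtains y where "y \<in> Y" "cdual_apply f y = cdual_apply z f"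
    "\<And>v a c. (v, a, c) \<in> K \<Longrightarrow> norm (v + c *\<^sub>C (z - canonical_embedding y)) \<le> R'"
proof -
  let ?J = "canonical_embedding :: 'a \<Rightarrow> 'a cdual cdual"
  obtain y1 where y1: "y1 \<in> Y" "cdual_apply f y1 = cdual_apply z f"
  proof (cases "\<forall>y\<in>Y. cdual_apply f y = 0")
    case True
    then have "cdual_apply z f = 0" by (intro z) auto
    then show thesis
      using Y by (intro that[of 0]) (auto simp: csubspace_def cdual_0)
  next
    case False
    then obtain y where "y \<in> Y" "cdual_apply f y \<noteq> 0" by blast
    then show thesis
      using csubspace_scaleC[OF Y]
      by (intro that[of "(cdual_apply z f / cdual_apply f y) *\<^sub>C y"]) (auto simp: cdual_scaleC)
  qed
  define Y' where "Y' = {y \<in> Y. cdual_apply f y = 0}"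
  define z' where "z' = z - ?J y1"
  have Y': "csubspace Y'"
    using Y by (auto simp: Y'_def csubspace_def cdual_add cdual_scaleC cdual_0)
  have z'0: "cdual_apply z' g = 0" if g: "\<And>y. y \<in> Y' \<Longrightarrow> cdual_apply g y = 0" for g
  proof (cases "\<forall>y\<in>Y. cdual_apply f y = 0")
    case True
    then have "cdual_apply z g = 0" "cdual_apply g y1 = 0"
      using g y1 by (auto intro!: z simp: Y'_def)
    then show ?thesis by (simp add: z'_def minus_cdual.rep_eq)
  next
    case False
    then obtain u where u: "u \<in> Y" "cdual_apply f u \<noteq> 0" by blast
    \<comment> \<open>A functional vanishing on the kernel of \<open>f\<close> in \<open>Y\<close>
      agrees on \<open>Y\<close> with a multiple of \<open>f\<close>, so
      \<open>g - l *\<^sub>C f\<close> annihilates \<open>Y\<close>. As \<open>z\<close> agrees with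
      \<open>y1\<close> on \<open>f\<close>, it does so on \<open>g\<close>.\<close>
    define l where "l = cdual_apply g u / cdual_apply f u"
    have gl: "cdual_apply g y = l * cdual_apply f y" if y: "y \<in> Y" for y
    proof -
      have "y - (cdual_apply f y / cdual_apply f u) *\<^sub>C u \<in> Y'"
        using u y csubspace_diff[OF Y] csubspace_scaleC[OF Y]
        by (auto simp: Y'_def cdual_diff cdual_scaleC)
      from g[OF this] show ?thesis by (simp add: cdual_diff cdual_scaleC l_def)
    qed
    have "cdual_apply z (g - l *\<^sub>C f) = 0"
      by (rule z) (simp add: gl minus_cdual.rep_eq scaleC_cdual.rep_eq)
    then show ?thesis
      using y1 by (simp add: z'_def minus_cdual.rep_eq cdual_diff cdual_scaleC gl)
  qed
  obtain y where y: "y \<in> Y'"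
    "\<And>v a c. (v, a, c) \<in> K \<Longrightarrow> norm (v + c *\<^sub>C (z' - ?J y)) \<le> R'"
  proof (rule M_embedded_compact_approximation[OF M Y' z'0 _ K _ v(2,3) R])
    show "cmod (cdual_apply \<psi> z') \<le> norm \<psi>" if "\<And>x. cdual_apply \<psi> (?J x) = 0" for \<psi>
      using d[OF that] by (simp add: z'_def cdual_diff that)
    show "v - a *\<^sub>C z' \<in> range ?J" if k: "(v, a, c) \<in> K" for v a c
    proof -
      have "a *\<^sub>C z = a *\<^sub>C z' + ?J (a *\<^sub>C y1)"
        by (simp add: z'_def canonical_embedding_scaleC flip: scaleC_add_right)
      moreover obtain x where "v - a *\<^sub>C z = ?J x"
        using v(1)[OF k] by blast
      ultimately have "v - a *\<^sub>C z' = ?J (x + a *\<^sub>C y1)"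
        by (simp add: canonical_embedding_add algebra_simps)
      then show ?thesis by simp
    qed
  qed blast+
  show thesis
  proof (rule that)
    show "y1 + y \<in> Y" using y1 y Y by (simp add: Y'_def csubspace_def)
    show "cdual_apply f (y1 + y) = cdual_apply z f" using y1 y by (simp add: Y'_def cdual_add)
    show "norm (v + c *\<^sub>C (z - ?J (y1 + y))) \<le> R'" if "(v, a, c) \<in> K" for v a c
      using y(2)[OF that] by (simp add: z'_def canonical_embedding_add diff_diff_add)
  qed
qed

section \<open>Almost isometric copies of \<open>c\<^sub>0\<close>\<close>

lemma scaleC_diff_right: "c *\<^sub>C (x - y) = c *\<^sub>C x - c *\<^sub>C y"
  using scaleC_add_right[of c "x - y" y] by (simp add: algebra_simps)

lemma scaleC_diff_left: "(c - d) *\<^sub>C x = c *\<^sub>C x - d *\<^sub>C x"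
  using scaleC_add_left[of "c - d" d x] by (simp add: algebra_simps)

lemma scaleC_zero_left: "0 *\<^sub>C x = 0"
  using scaleC_diff_left[of 0 0 x] by simp

lemma scaleC_minus_left: "(- c) *\<^sub>C x = - (c *\<^sub>C x)"
  using scaleC_diff_left[of 0 c x] by (simp add: scaleC_zero_left)

lemma scaleC_sum_right: "c *\<^sub>C (\<Sum>i\<in>I. f i) = (\<Sum>i\<in>I. c *\<^sub>C f i)"
proof (induction I rule: infinite_finite_induct)
  case (insert i I)
  then show ?case by (simp add: scaleC_add_right)
qed (use scaleC_diff_right[of c 0 0] in auto)

text \<open>
  For the lower estimate write \<open>v = a + u\<close> with \<open>a = \<alpha> k x k\<close>. The upper estimate applies to
  \<open>a - l u\<close>, where \<open>l\<close> is chosen to balance the two parts, and \<open>(1 + l) a = l v + (a - l u)\<close>.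
\<close>

lemma lower_estimate:
  fixes x :: "nat \<Rightarrow> 'a::complex_normed_vector"
  assumes upper: "\<And>m \<alpha> B. (\<And>n. n \<le> m \<Longrightarrow> s n * cmod (\<alpha> n) \<le> B) \<Longrightarrow> norm (\<Sum>n\<le>m. \<alpha> n *\<^sub>C x n) \<le> B"
    and s: "\<And>n. 0 < s n" and x: "1 - \<eta> \<le> norm (x k)" "1 - \<eta> \<le> s k" and k: "k \<le> m"
    and B: "\<And>n. n \<le> m \<Longrightarrow> s n * cmod (\<alpha> n) \<le> B"
  shows "(1 - \<eta>) * cmod (\<alpha> k) \<le> norm (\<Sum>n\<le>m. \<alpha> n *\<^sub>C x n) + (s k - 1 + \<eta>) * (B / s k)"
proof (cases "\<alpha> k = 0")
  case True
  have "0 \<le> B" using B[OF k] True by simp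
  then have "0 \<le> (s k - 1 + \<eta>) * (B / s k)"
    using s[of k] x(2) by (intro mult_nonneg_nonneg) auto
  then show ?thesis using True by (simp add: add_nonneg_nonneg)
next
  case False
  define v where "v = (\<Sum>n\<le>m. \<alpha> n *\<^sub>C x n)"
  define a where "a = \<alpha> k *\<^sub>C x k"
  have ak: "0 < s k * cmod (\<alpha> k)" using False s[of k] by simp
  with B[OF k] have Bpos: "0 < B" by linarith
  \<comment> \<open>This makes \<open>l * B\<close> equal to \<open>s k * cmod (\<alpha> k)\<close>,
    so all weighted coefficients of \<open>a - l u\<close> are at most that number.\<close>
  define l where "l = s k * cmod (\<alpha> k) / B"
  have l: "0 < l" "l * B = s k * cmod (\<alpha> k)"
    using ak Bpos by (auto simp: l_def)
  define \<beta> where "\<beta> n = (if n = k then \<alpha> n else - of_real l * \<alpha> n)" for n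
  have "(\<Sum>n\<le>m. \<beta> n *\<^sub>C x n) = (\<Sum>n\<le>m. (if n = k then (1 + l) *\<^sub>R a else 0) - l *\<^sub>R (\<alpha> n *\<^sub>C x n))"
    by (rule sum.cong)
       (auto simp: \<beta>_def a_def scaleR_scaleC scaleC_scaleC scaleC_minus_left scaleC_add_left
         distrib_right)
  also have "\<dots> = (1 + l) *\<^sub>R a - l *\<^sub>R v"
    using k by (simp add: sum_subtractf v_def scaleR_sum_right)
  finally have \<beta>: "(\<Sum>n\<le>m. \<beta> n *\<^sub>C x n) = (1 + l) *\<^sub>R a - l *\<^sub>R v" .
  have "norm ((1 + l) *\<^sub>R a - l *\<^sub>R v) \<le> s k * cmod (\<alpha> k)"
    unfolding \<beta>[symmetric]
  proof (rule upper)
    fix n assume "n \<le> m"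
    then have "l * (s n * cmod (\<alpha> n)) \<le> l * B"
      using B l(1) by (intro mult_left_mono) auto
    with l(2) have "l * (s n * cmod (\<alpha> n)) \<le> s k * cmod (\<alpha> k)" by simp
    then show "s n * cmod (\<beta> n) \<le> s k * cmod (\<alpha> k)"
      using l(1) by (simp add: \<beta>_def norm_mult mult.left_commute)
  qed
  moreover have "norm ((1 + l) *\<^sub>R a) \<le> norm ((1 + l) *\<^sub>R a - l *\<^sub>R v) + norm (l *\<^sub>R v)"
    using norm_triangle_ineq[of "(1 + l) *\<^sub>R a - l *\<^sub>R v" "l *\<^sub>R v"] by simp
  ultimately have "(1 + l) * norm a \<le> s k * cmod (\<alpha> k) + l * norm v"
    using l(1) by simp
  moreover have "(1 + l) * ((1 - \<eta>) * cmod (\<alpha> k)) \<le> (1 + l) * norm a"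
    using x(1) l(1) by (intro mult_left_mono) (auto simp: a_def norm_scaleC mult.commute intro: mult_right_mono)
  ultimately have *: "l * ((1 - \<eta>) * cmod (\<alpha> k)) \<le> l * norm v + (s k - 1 + \<eta>) * cmod (\<alpha> k)"
    by (simp add: algebra_simps)
  \<comment> \<open>In the error term \<open>cmod (\<alpha> k)\<close> is replaced by
    \<open>l * q\<close>, after which the common factor \<open>l\<close> cancels.\<close>
  define q where "q = B / s k"
  have \<alpha>k: "cmod (\<alpha> k) = l * q"
    using l(2) s[of k] by (simp add: q_def field_simps)
  have "l * ((1 - \<eta>) * cmod (\<alpha> k)) \<le> l * (norm v + (s k - 1 + \<eta>) * q)"
    using * unfolding \<alpha>k by (simp add: algebra_simps)
  then show ?thesis
    using l(1) by (simp add: v_def q_def)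
qed

text \<open>The upper bound extends to all \<open>B\<close> by homogeneity. For the lower bound,
  \<open>lower_estimate\<close> leaves an error proportional to the largest weighted coefficient.
  Used at the index of that coefficient, it bounds the latter by twice the norm of the sum; used
  again at \<open>k\<close>, it leaves only a small multiple of this norm.\<close>

lemma spans_c0_asymptoticallyI:
  fixes x :: "nat \<Rightarrow> 'a::complex_normed_vector"
  assumes upper1: "\<And>m \<alpha>. (\<And>n. n \<le> m \<Longrightarrow> s n * cmod (\<alpha> n) \<le> 1) \<Longrightarrow> norm (\<Sum>n\<le>m. \<alpha> n *\<^sub>C x n) \<le> 1"
    and s: "\<And>n. 1 \<le> s n" "\<And>n. s n \<le> 11/10" "s \<longlonglongrightarrow> 1"
    and \<eta>: "\<And>n. 0 \<le> \<eta> n" "\<And>n. \<eta> n \<le> 1/10" "\<eta> \<longlonglongrightarrow> 0"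
    and x: "\<And>n. 1 - \<eta> n \<le> norm (x n)"
  shows "spans_c0_asymptotically x"
proof -
  have spos: "0 < s n" for n using s(1)[of n] by simp
  have upper: "norm (\<Sum>n\<le>m. \<alpha> n *\<^sub>C x n) \<le> B"
    if B: "\<And>n. n \<le> m \<Longrightarrow> s n * cmod (\<alpha> n) \<le> B" for m \<alpha> B
  proof (cases "B = 0")
    case True
    have "\<alpha> n = 0" if "n \<le> m" for n
      using B[OF that] spos[of n] True by (simp add: mult_le_0_iff)
    then show ?thesis using True by (simp add: scaleC_zero_left)
  next
    case False
    have "0 \<le> s 0 * cmod (\<alpha> 0)" using spos[of 0] by simp
    with B[of 0] False have Bpos: "0 < B" by simp
    have "(\<Sum>n\<le>m. (\<alpha> n / of_real B) *\<^sub>C x n) = inverse B *\<^sub>R (\<Sum>n\<le>m. \<alpha> n *\<^sub>C x n)"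
      by (simp add: scaleR_scaleC scaleC_sum_right scaleC_scaleC divide_inverse mult.commute)
    moreover have "norm (\<Sum>n\<le>m. (\<alpha> n / of_real B) *\<^sub>C x n) \<le> 1"
      by (rule upper1) (use B Bpos in \<open>simp add: norm_divide\<close>)
    ultimately show ?thesis
      using Bpos by (simp add: field_simps)
  qed
  define \<epsilon> where "\<epsilon> n = s n - 1 + \<eta> n" for n
  \<comment> \<open>This choice gives
    \<open>(1 + 2 * \<epsilon> k) * (1 - \<delta> k) \<le> 1 - \<eta> k\<close> for the lower
    estimate and \<open>s k \<le> 1 + \<delta> k\<close> for the upper one.\<close>
  define \<delta> where "\<delta> n = \<eta> n + 2 * \<epsilon> n" for n
  have \<epsilon>: "0 \<le> \<epsilon> n" "\<epsilon> n \<le> 2/10" for n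
    using s(1,2)[of n] \<eta>(1,2)[of n] by (auto simp: \<epsilon>_def)
  have \<delta>: "0 \<le> \<delta> n" "\<delta> n < 1" "s n \<le> 1 + \<delta> n" for n
    using s(1,2)[of n] \<eta>(1,2)[of n] \<epsilon>[of n] by (auto simp: \<delta>_def \<epsilon>_def)
  have "\<delta> \<longlonglongrightarrow> 0 + 2 * (1 - 1 + 0)"
    unfolding \<delta>_def \<epsilon>_def by (intro tendsto_intros s \<eta>)
  then have lim: "\<delta> \<longlonglongrightarrow> 0" by simp
  have lower: "(1 - \<delta> k) * cmod (\<alpha> k) \<le> norm (\<Sum>n\<le>m. \<alpha> n *\<^sub>C x n)" if k: "k \<le> m" for k m \<alpha>
  proof -
    define N where "N = norm (\<Sum>n\<le>m. \<alpha> n *\<^sub>C x n)"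
    obtain j where j: "j \<le> m" "\<And>n. n \<le> m \<Longrightarrow> s n * cmod (\<alpha> n) \<le> s j * cmod (\<alpha> j)"
    proof -
      let ?S = "(\<lambda>n. s n * cmod (\<alpha> n)) ` {..m}"
      have "Max ?S \<in> ?S" by (rule Max_in) auto
      then obtain j where "j \<le> m" "Max ?S = s j * cmod (\<alpha> j)" by blast
      moreover have "s n * cmod (\<alpha> n) \<le> Max ?S" if "n \<le> m" for n
        using that by (intro Max_ge) auto
      ultimately show thesis using that by simp
    qed
    define b where "b = cmod (\<alpha> j)"
    have "1 - \<eta> n \<le> s n" for n using s(1)[of n] \<eta>(1)[of n] by simp
    then have low: "(1 - \<eta> k) * cmod (\<alpha> k) \<le> N + (s k - 1 + \<eta> k) * (s j * b / s k)" if "k \<le> m" for k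
      unfolding N_def b_def by (intro lower_estimate[OF _ spos x _ that j(2)] upper)
    \<comment> \<open>At the maximal index \<open>j\<close> the error is
      \<open>\<epsilon> j * b\<close> and is absorbed on the left. Since
      \<open>1 - 1/10 - 2/10 = 7/10\<close>, this yields
      \<open>s j * b \<le> 11/7 * N\<close>.\<close>
    have "(1 - \<eta> j) * b \<le> N + \<epsilon> j * b"
      using low[OF j(1)] spos[of j] by (simp add: \<epsilon>_def b_def)
    then have "(1 - \<eta> j - \<epsilon> j) * b \<le> N" by (simp add: algebra_simps)
    moreover have "7/10 * b \<le> (1 - \<eta> j - \<epsilon> j) * b"
      using \<eta>(2)[of j] \<epsilon>(2)[of j] by (intro mult_right_mono) (auto simp: b_def)
    moreover have "s j * b \<le> 11/10 * b"
      using s(2)[of j] by (intro mult_right_mono) (auto simp: b_def)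
    moreover have "0 \<le> b" by (simp add: b_def)
    ultimately have sb: "s j * b \<le> 2 * N" by linarith
    have N: "0 \<le> N" by (simp add: N_def)
    have "s j * b / s k \<le> s j * b / 1"
      using s(1)[of k] spos[of j] \<open>0 \<le> b\<close> by (intro divide_left_mono) auto
    with sb have "\<epsilon> k * (s j * b / s k) \<le> \<epsilon> k * (2 * N)"
      using \<epsilon>(1)[of k] by (intro mult_left_mono) auto
    with low[OF k] have "(1 - \<eta> k) * cmod (\<alpha> k) \<le> (1 + 2 * \<epsilon> k) * N"
      by (simp add: \<epsilon>_def algebra_simps)
    moreover have "(1 + 2 * \<epsilon> k) * ((1 - \<delta> k) * cmod (\<alpha> k)) \<le> (1 - \<eta> k) * cmod (\<alpha> k)"
    proof -
      have "(1 + 2 * \<epsilon> k) * (1 - \<delta> k) = 1 - \<eta> k - 2 * (\<epsilon> k * \<eta> k) - 4 * (\<epsilon> k * \<epsilon> k)"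
        by (simp add: \<delta>_def algebra_simps)
      also have "\<dots> \<le> 1 - \<eta> k"
        using mult_nonneg_nonneg[OF \<epsilon>(1) \<eta>(1), of k k] zero_le_square[of "\<epsilon> k"] by linarith
      finally show ?thesis
        unfolding mult.assoc[symmetric] by (rule mult_right_mono) simp
    qed
    ultimately have "(1 + 2 * \<epsilon> k) * ((1 - \<delta> k) * cmod (\<alpha> k)) \<le> (1 + 2 * \<epsilon> k) * N" by linarith
    then show ?thesis
      using \<epsilon>(1)[of k] by (simp add: N_def)
  qed
  show ?thesis
    unfolding spans_c0_asymptotically_def
  proof (intro conjI allI exI[of _ \<delta>])
    show "x n \<noteq> 0" for n
      using x[of n] \<eta>(2)[of n] by auto
    show "0 \<le> \<delta> n" "\<delta> n < 1" for n by (rule \<delta>)+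
    show "\<delta> \<longlonglongrightarrow> 0" by (rule lim)
    fix m \<alpha>
    show "(SUP n\<in>{..m}. (1 - \<delta> n) * cmod (\<alpha> n)) \<le> norm (\<Sum>n\<le>m. \<alpha> n *\<^sub>C x n)"
      by (rule cSUP_least) (auto intro: lower)
    show "norm (\<Sum>n\<le>m. \<alpha> n *\<^sub>C x n) \<le> (SUP n\<in>{..m}. (1 + \<delta> n) * cmod (\<alpha> n))"
    proof (rule upper)
      fix n assume "n \<le> m"
      then have "(1 + \<delta> n) * cmod (\<alpha> n) \<le> (SUP n\<in>{..m}. (1 + \<delta> n) * cmod (\<alpha> n))"
        by (intro cSUP_upper) auto
      moreover have "s n * cmod (\<alpha> n) \<le> (1 + \<delta> n) * cmod (\<alpha> n)"
        using \<delta>(3) by (intro mult_right_mono) auto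
      ultimately show "s n * cmod (\<alpha> n) \<le> (SUP n\<in>{..m}. (1 + \<delta> n) * cmod (\<alpha> n))" by linarith
    qed
  qed
qed

section \<open>Inductive construction of the sequence\<close>

lemma compact_polydisc:
  fixes r :: "nat \<Rightarrow> real"
  shows "compact {\<alpha> :: nat \<Rightarrow> complex. \<forall>n. cmod (\<alpha> n) \<le> r n}"
proof -
  have "compactin (product_topology (\<lambda>_. euclidean) UNIV) (PiE UNIV (\<lambda>n. cball (0::complex) (r n)))"
    by (simp add: compactin_PiE)
  moreover have "PiE UNIV (\<lambda>n. cball 0 (r n)) = {\<alpha> :: nat \<Rightarrow> complex. \<forall>n. cmod (\<alpha> n) \<le> r n}"
    by (auto simp: PiE_UNIV_domain Pi_iff)
  ultimately show ?thesis
    by (simp add: euclidean_product_topology)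
qed

lemma continuous_on_scaleC_left:
  fixes u :: "'a::complex_normed_vector"
  assumes "continuous_on S f"
  shows "continuous_on S (\<lambda>t. f t *\<^sub>C u)"
proof -
  have "bounded_linear (\<lambda>c. c *\<^sub>C u)"
    by (rule bounded_linear_intro[where K = "norm u"])
       (simp_all add: scaleC_add_left scaleR_scaleC scaleC_scaleC norm_scaleC scaleC_complex_def)
  then show ?thesis using assms by (rule bounded_linear.continuous_on)
qed

text \<open>Each step applies the constrained lemma with \<open>R = 1 / s (Suc m)\<close> and
  \<open>R' = 1 / s (Suc (Suc m))\<close>. The strict decrease of \<open>s\<close> provides the room
  lost at each step, while \<open>1 \<le> s n\<close> keeps all bounds at most
  \<open>1\<close>.\<close>

lemma M_embedded_c0_sequence:
  fixes z :: "'a::cbanach cdual cdual" and Y :: "'a set" and s \<eta> :: "nat \<Rightarrow> real"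
  assumes M: "M_embedded TYPE('a)" and Y: "csubspace Y"
    and z: "\<And>f. (\<And>y. y \<in> Y \<Longrightarrow> cdual_apply f y = 0) \<Longrightarrow> cdual_apply z f = 0"
    and d: "\<And>\<psi>. (\<And>x. cdual_apply \<psi> (canonical_embedding x) = 0) \<Longrightarrow> cmod (cdual_apply \<psi> z) \<le> norm \<psi>"
    and far: "\<And>x. 1 \<le> norm (z - canonical_embedding x)"
    and s: "\<And>n. 1 \<le> s n" "\<And>n. s (Suc n) < s n" and \<eta>: "\<And>n. 0 < \<eta> n" "\<And>n. \<eta> n \<le> 1"
  obtains x where "\<And>n. x n \<in> Y" "\<And>n. 1 - \<eta> n \<le> norm (x n)"
    "\<And>m \<alpha>. (\<And>n. n \<le> m \<Longrightarrow> s n * cmod (\<alpha> n) \<le> 1) \<Longrightarrow> norm (\<Sum>n\<le>m. \<alpha> n *\<^sub>C x n) \<le> 1"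
proof -
  let ?J = "canonical_embedding :: 'a \<Rightarrow> 'a cdual cdual"
  \<comment> \<open>Every \<open>\<alpha>\<close> in \<open>D\<close> satisfies
    \<open>cmod (\<alpha> (Suc m)) \<le> 1 / s (Suc m)\<close>, which is the condition on
    \<open>a + c\<close> in the approximation lemma.\<close>
  define D where "D = {\<alpha> :: nat \<Rightarrow> complex. \<forall>n. cmod (\<alpha> n) \<le> 1 / s n}"
  \<comment> \<open>A state consists of the current approximation \<open>y m\<close> and the map
    sending \<open>\<alpha>\<close> to \<open>\<alpha> 0 x 0 + ... + \<alpha> (m - 1) x (m - 1) +
    \<alpha> m (z - y m)\<close>. Carrying the map along makes its continuity and its bound on
    \<open>D\<close> part of the invariant; the formula is recovered later from \<open>N\<close> and
    the case \<open>m = 0\<close>.\<close>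
  define Q where "Q m p \<longleftrightarrow> fst p \<in> Y \<and> continuous_on UNIV (snd p) \<and>
      (\<forall>\<alpha>. snd p \<alpha> - \<alpha> m *\<^sub>C z \<in> range ?J) \<and> (\<forall>\<alpha>\<in>D. norm (snd p \<alpha>) \<le> 1 / s (Suc m)) \<and>
      (m = 0 \<longrightarrow> (\<forall>\<alpha>. snd p \<alpha> = \<alpha> 0 *\<^sub>C (z - ?J (fst p))))"
    for m :: nat and p :: "'a \<times> ((nat \<Rightarrow> complex) \<Rightarrow> 'a cdual cdual)"
  define N where "N m p q \<longleftrightarrow> 1 - \<eta> m \<le> norm (fst q - fst p) \<and>
      (\<forall>\<alpha>. snd q \<alpha> = snd p \<alpha> + (\<alpha> (Suc m) - \<alpha> m) *\<^sub>C (z - ?J (fst q)))"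
    for m :: nat and p q :: "'a \<times> ((nat \<Rightarrow> complex) \<Rightarrow> 'a cdual cdual)"
  have spos: "0 < s n" for n using s(1)[of n] by simp
  \<comment> \<open>This is Tychonoff's theorem for the product topology. Thanks to compactness a
    single choice of the next \<open>y\<close> serves all coefficient sequences.\<close>
  have D_compact: "compact D"
    unfolding D_def by (rule compact_polydisc)
  have coord: "continuous_on A (\<lambda>\<alpha>::nat \<Rightarrow> complex. \<alpha> n)" for A n
    by (rule continuous_on_subset[OF continuous_on_product_coordinates]) simp
  have J0: "?J 0 = 0"
    using canonical_embedding_diff[of 0 "0::'a"] by simp
  have "\<exists>p. Q 0 p"
  proof -
    \<comment> \<open>The triple \<open>(0, 0, 1)\<close> asks for \<open>norm (z - ?J y)\<close> to
      be at most \<open>s 0 / s 1\<close>; the bound \<open>1 / s 0\<close> on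
      \<open>\<alpha> 0\<close> turns this into \<open>1 / s 1\<close>.\<close>
    obtain y where y: "y \<in> Y"
      "\<And>v a c. (v, a, c) \<in> {(0, 0, 1)} \<Longrightarrow> norm (v + c *\<^sub>C (z - ?J y)) \<le> s 0 / s (Suc 0)"
    proof (rule M_embedded_compact_approximation[OF M Y z d, where K = "{(0, 0, 1)}" and R = 1])
      show "1 < s 0 / s (Suc 0)" using s(2)[of 0] spos by simp
      show "v - a *\<^sub>C z \<in> range ?J" if "(v, a, c) \<in> {(0, 0, 1::complex)}" for v a c
        using that rangeI[of ?J 0] by (simp add: J0 scaleC_zero_left)
    qed auto
    have y': "norm (z - ?J y) \<le> s 0 / s (Suc 0)"
      using y(2)[of 0 0 1] by (simp add: scaleC_one)
    have "norm (\<alpha> 0 *\<^sub>C (z - ?J y)) \<le> 1 / s (Suc 0)" if "\<alpha> \<in> D" for \<alpha>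
    proof -
      have "cmod (\<alpha> 0) * norm (z - ?J y) \<le> 1 / s 0 * (s 0 / s (Suc 0))"
        using that y' spos[of 0] by (intro mult_mono) (auto simp: D_def)
      then show ?thesis using spos[of 0] by (simp add: norm_scaleC)
    qed
    moreover have "\<alpha> *\<^sub>C (z - ?J y) - \<alpha> *\<^sub>C z = ?J ((- \<alpha>) *\<^sub>C y)" for \<alpha>
      using scaleC_diff_left[of 0 \<alpha> "?J y"]
      by (simp add: scaleC_diff_right canonical_embedding_scaleC scaleC_zero_left)
    ultimately have "Q 0 (y, \<lambda>\<alpha>. \<alpha> 0 *\<^sub>C (z - ?J y))"
      using y(1) by (auto simp: Q_def intro!: continuous_on_scaleC_left coord)
    then show ?thesis ..
  qed
  moreover have "\<exists>q. Q (Suc m) q \<and> N m p q" if Qp: "Q m p" for m p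
  proof -
    obtain y V where p: "p = (y, V)" by fastforce
    from Qp have y: "y \<in> Y" and cont: "continuous_on UNIV V"
      and V: "\<And>\<alpha>. V \<alpha> - \<alpha> m *\<^sub>C z \<in> range ?J" "\<And>\<alpha>. \<alpha> \<in> D \<Longrightarrow> norm (V \<alpha>) \<le> 1 / s (Suc m)"
      by (auto simp: Q_def p)
    \<comment> \<open>As \<open>z - ?J y\<close> has norm at least \<open>1\<close>, some
      \<open>f\<close> almost norms it. Once \<open>y'\<close> agrees with \<open>z\<close> on
      \<open>f\<close>, the value of \<open>f\<close> at \<open>y' - y\<close> is that of
      \<open>z - ?J y\<close> at \<open>f\<close>, so \<open>y' - y\<close> has norm at least
      \<open>1 - \<eta> m\<close>.\<close>
    obtain f where f: "(1 - \<eta> m) * norm f < cmod (cdual_apply (z - ?J y) f)"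
    proof (rule ccontr)
      assume "\<not> thesis"
      with that have "cmod (cdual_apply (z - ?J y) f) \<le> (1 - \<eta> m) * norm f" for f
        by (meson not_less)
      then have "norm (z - ?J y) \<le> 1 - \<eta> m"
        using \<eta>(2)[of m] by (intro norm_cdual_leI) auto
      with far[of y] \<eta>(1)[of m] show False by simp
    qed
    let ?K = "(\<lambda>\<alpha>. (V \<alpha>, \<alpha> m, \<alpha> (Suc m) - \<alpha> m)) ` D"
    obtain y' where y': "y' \<in> Y" "cdual_apply f y' = cdual_apply z f"
      "\<And>v a c. (v, a, c) \<in> ?K \<Longrightarrow> norm (v + c *\<^sub>C (z - ?J y')) \<le> 1 / s (Suc (Suc m))"
    proof (rule M_embedded_compact_approximation_constrained[OF M Y z d, where K = ?K and R = "1 / s (Suc m)"])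
      show "compact ?K"
        by (intro compact_continuous_image D_compact continuous_intros coord
            continuous_on_subset[OF cont]) simp
      show "v - a *\<^sub>C z \<in> range ?J" "norm v \<le> 1 / s (Suc m)" "cmod (a + c) \<le> 1 / s (Suc m)"
        if "(v, a, c) \<in> ?K" for v a c
        using that V by (auto simp: D_def)
      show "0 < 1 / s (Suc m)" using spos by simp
      show "1 / s (Suc m) < 1 / s (Suc (Suc m))"
        using s(2)[of "Suc m"] spos by (simp add: frac_less2)
    qed auto
    define V' where "V' \<alpha> = V \<alpha> + (\<alpha> (Suc m) - \<alpha> m) *\<^sub>C (z - ?J y')" for \<alpha> :: "nat \<Rightarrow> complex"
    have "cdual_apply (z - ?J y) f = cdual_apply f (y' - y)"
      by (simp add: minus_cdual.rep_eq cdual_diff y'(2))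
    then have less: "(1 - \<eta> m) * norm f < norm (y' - y) * norm f"
      using f norm_cdual_apply[of f "y' - y"] by (simp add: mult.commute)
    then have "1 - \<eta> m \<le> norm (y' - y)"
      using mult_right_mono[of "norm (y' - y)" "1 - \<eta> m" "norm f"] by (auto simp: not_less[symmetric])
    then have "N m p (y', V')"
      by (simp add: N_def p V'_def)
    moreover have "Q (Suc m) (y', V')"
      unfolding Q_def fst_conv snd_conv
    proof (intro conjI allI ballI impI)
      show "y' \<in> Y" by (rule y'(1))
      show "continuous_on UNIV V'"
        unfolding V'_def by (intro continuous_intros cont continuous_on_scaleC_left coord)
      show "V' \<alpha> - \<alpha> (Suc m) *\<^sub>C z \<in> range ?J" for \<alpha>
      proof -
        obtain u where "V \<alpha> - \<alpha> m *\<^sub>C z = ?J u" using V(1) by blast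
        then have "V' \<alpha> - \<alpha> (Suc m) *\<^sub>C z = ?J (u - (\<alpha> (Suc m) - \<alpha> m) *\<^sub>C y')"
          by (simp add: V'_def scaleC_diff_right scaleC_diff_left canonical_embedding_diff
              canonical_embedding_add canonical_embedding_scaleC algebra_simps)
        then show ?thesis by simp
      qed
      show "norm (V' \<alpha>) \<le> 1 / s (Suc (Suc m))" if "\<alpha> \<in> D" for \<alpha>
        unfolding V'_def using that by (intro y'(3)[of _ "\<alpha> m"]) blast
    qed simp
    ultimately show ?thesis by blast
  qed
  ultimately obtain g where Q: "\<And>n. Q n (g n)" and N: "\<And>n. N n (g n) (g (Suc n))"
    using dependent_nat_choice[of Q N] by blast
  define y where "y n = fst (g n)" for n
  define x where "x n = y (Suc n) - y n" for n
  have expand: "snd (g m) \<alpha> = ?J (\<Sum>n<m. \<alpha> n *\<^sub>C x n) + \<alpha> m *\<^sub>C (z - ?J (y m))" for m \<alpha>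
  proof (induction m)
    case 0
    then show ?case using Q[of 0] by (simp add: Q_def y_def J0)
  next
    case (Suc m)
    have "snd (g (Suc m)) \<alpha> = snd (g m) \<alpha> + (\<alpha> (Suc m) - \<alpha> m) *\<^sub>C (z - ?J (y (Suc m)))"
      using N[of m] by (simp add: N_def y_def)
    then show ?case
      by (simp add: Suc x_def canonical_embedding_add canonical_embedding_diff
          canonical_embedding_scaleC scaleC_diff_left scaleC_diff_right)
  qed
  show thesis
  proof (rule that)
    show "x n \<in> Y" for n
      using Q[of n] Q[of "Suc n"] csubspace_diff[OF Y] by (simp add: x_def y_def Q_def)
    show "1 - \<eta> n \<le> norm (x n)" for n
      using N[of n] by (simp add: N_def x_def y_def)
    fix m \<alpha> assume \<alpha>: "\<And>n. n \<le> m \<Longrightarrow> s n * cmod (\<alpha> n) \<le> 1"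
    \<comment> \<open>Coefficients after \<open>m\<close> are set to zero, so that the sequence lies
      in \<open>D\<close> and the term with \<open>z\<close> in the state \<open>Suc m\<close>
      disappears.\<close>
    define \<beta> where "\<beta> n = (if n \<le> m then \<alpha> n else 0)" for n
    have "cmod (\<beta> n) \<le> 1 / s n" for n
      using \<alpha>[of n] spos[of n] by (simp add: \<beta>_def field_simps)
    then have "norm (snd (g (Suc m)) \<beta>) \<le> 1 / s (Suc (Suc m))"
      using Q[of "Suc m"] by (simp add: Q_def D_def)
    also have "\<dots> \<le> 1"
      using s(1)[of "Suc (Suc m)"] by simp
    also have "snd (g (Suc m)) \<beta> = ?J (\<Sum>n\<le>m. \<beta> n *\<^sub>C x n)"
      unfolding expand lessThan_Suc_atMost by (simp add: \<beta>_def scaleC_zero_left)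
    also have "(\<Sum>n\<le>m. \<beta> n *\<^sub>C x n) = (\<Sum>n\<le>m. \<alpha> n *\<^sub>C x n)"
      by (rule sum.cong) (simp_all add: \<beta>_def)
    finally show "norm (\<Sum>n\<le>m. \<alpha> n *\<^sub>C x n) \<le> 1" by simp
  qed
qed

section \<open>Nonreflexive subspaces\<close>

text \<open>The quotient at \<open>0\<close> is \<open>0 / 0 = 0\<close>, which makes the supremum
  nonnegative.\<close>

lemma dual_norm_restrict:
  assumes "0 \<in> V"
  shows "0 \<le> dual_norm V (\<lambda>x. if x \<in> V then cdual_apply f x else 0)"
    and "dual_norm V (\<lambda>x. if x \<in> V then cdual_apply f x else 0) \<le> norm f"
proof -
  let ?q = "\<lambda>x. cmod (if x \<in> V then cdual_apply f x else 0) / norm x"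
  have q: "?q x \<le> norm f" for x
    using norm_cdual_apply[of f x] by (cases "x = 0") (auto simp: field_simps)
  show "dual_norm V (\<lambda>x. if x \<in> V then cdual_apply f x else 0) \<le> norm f"
    unfolding dual_norm_def by (rule cSUP_least) (use assms in blast, rule q)
  have "?q 0 \<le> (SUP x\<in>V. ?q x)"
    by (rule cSUP_upper[OF assms bdd_aboveI2[OF q]])
  then show "0 \<le> dual_norm V (\<lambda>x. if x \<in> V then cdual_apply f x else 0)"
    by (simp add: dual_norm_def)
qed

text \<open>A functional \<open>\<Phi>\<close> on the dual of \<open>Y\<close> without representing
  vector is carried to X'' by restricting functionals to \<open>Y\<close>. If some \<open>x\<close>
  in X represented the result, separation would place \<open>x\<close> in \<open>Y\<close>, and
  \<open>x\<close> would represent \<open>\<Phi>\<close> because every functional on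
  \<open>Y\<close> extends to X.\<close>

lemma nonreflexive_subspace_bidual_element:
  fixes Y :: "'a::cbanach set"
  assumes Y: "csubspace Y" "closed Y" "\<not> reflexive_subspace Y"
  obtains z :: "'a cdual cdual" where
    "\<And>f. (\<And>y. y \<in> Y \<Longrightarrow> cdual_apply f y = 0) \<Longrightarrow> cdual_apply z f = 0"
    "z \<notin> range canonical_embedding"
proof -
  have Y0: "0 \<in> Y" using Y(1) by (simp add: csubspace_def)
  define r where "r f = (\<lambda>x. if x \<in> Y then cdual_apply f x else 0)" for f :: "'a cdual"
  obtain \<Phi> where \<Phi>: "\<Phi> \<in> bidual_on Y" and nonrep: "\<And>v. v \<in> Y \<Longrightarrow> \<exists>f\<in>dual_on Y. \<Phi> f \<noteq> f v"
    using Y(3) by (auto simp: reflexive_subspace_def)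
  have r: "r f \<in> dual_on Y" for f
  proof -
    have "cmod (r f x) \<le> norm f * norm x" for x
      using norm_cdual_apply[of f x] by (simp add: r_def)
    then have "\<exists>K. \<forall>x\<in>Y. cmod (r f x) \<le> K * norm x" by blast
    then show ?thesis
      using Y(1) by (auto simp: dual_on_def r_def csubspace_def cdual_add cdual_scaleC)
  qed
  have \<Phi>_add: "\<Phi> (\<lambda>x. f x + g x) = \<Phi> f + \<Phi> g" if "f \<in> dual_on Y" "g \<in> dual_on Y" for f g
    using \<Phi> that unfolding bidual_on_def by blast
  have \<Phi>_scale: "\<Phi> (\<lambda>x. c * f x) = c * \<Phi> f" if "f \<in> dual_on Y" for c f
    using \<Phi> that unfolding bidual_on_def by blast
  obtain K where K: "\<And>f. f \<in> dual_on Y \<Longrightarrow> cmod (\<Phi> f) \<le> K * dual_norm Y f"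
    using \<Phi> unfolding bidual_on_def by blast
  have add: "\<Phi> (r (f + g)) = \<Phi> (r f) + \<Phi> (r g)" for f g
  proof -
    have "r (f + g) = (\<lambda>x. r f x + r g x)"
      by (auto simp: r_def plus_cdual.rep_eq)
    then show ?thesis using \<Phi>_add[OF r r] by simp
  qed
  have scale: "\<Phi> (r (c *\<^sub>C f)) = c * \<Phi> (r f)" for c f
  proof -
    have "r (c *\<^sub>C f) = (\<lambda>x. c * r f x)"
      by (auto simp: r_def scaleC_cdual.rep_eq)
    then show ?thesis using \<Phi>_scale[OF r] by simp
  qed
  have bound: "cmod (\<Phi> (r f)) \<le> \<bar>K\<bar> * norm f" for f
  proof -
    have "cmod (\<Phi> (r f)) \<le> K * dual_norm Y (r f)"
      by (rule K[OF r])
    also have "\<dots> \<le> \<bar>K\<bar> * norm f"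
      using dual_norm_restrict[OF Y0, of f] by (intro mult_mono) (auto simp: r_def)
    finally show ?thesis .
  qed
  have "bounded_linear (\<lambda>f. \<Phi> (r f))"
    by (rule bounded_linear_intro[where K = "\<bar>K\<bar>"])
       (use bound in \<open>auto simp: add scale scaleR_scaleC scaleC_complex_def mult.commute\<close>)
  then have "bounded_clinear (\<lambda>f. \<Phi> (r f))"
    by (simp add: bounded_clinear_def scale scaleC_complex_def)
  then obtain z :: "'a cdual cdual" where z: "\<And>f. cdual_apply z f = \<Phi> (r f)"
    using Abs_cdual_inverse[of "\<lambda>f. \<Phi> (r f)"] by (metis mem_Collect_eq)
  show thesis
  proof (rule that)
    fix f :: "'a cdual" assume "\<And>y. y \<in> Y \<Longrightarrow> cdual_apply f y = 0"
    then have "r f = r 0" by (auto simp: r_def zero_cdual.rep_eq)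
    \<comment> \<open>Writing the zero functional as a multiple by \<open>0\<close> lets the
      homogeneity of \<open>\<Phi>\<close> give the value \<open>0\<close>.\<close>
    then have "\<Phi> (r f) = \<Phi> (r (0 *\<^sub>C 0))" by (simp add: scaleC_zero_left)
    then show "cdual_apply z f = 0" unfolding z scale by simp
  next
    show "z \<notin> range canonical_embedding"
    proof
      assume "z \<in> range canonical_embedding"
      then obtain x where x: "\<And>f. \<Phi> (r f) = cdual_apply f x"
        using z by (metis canonical_embedding_apply rangeE)
      have "x \<in> Y"
      proof (rule ccontr)
        assume "x \<notin> Y"
        then obtain f where f: "\<And>v. v \<in> Y \<Longrightarrow> cdual_apply f v = 0" "cdual_apply f x \<noteq> 0"
          by (rule cdual_separation[OF Y(1,2)]) blast
        have "r f = r 0" using f(1) by (auto simp: r_def zero_cdual.rep_eq)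
        with x[of f] x[of 0] f(2) show False by (simp add: zero_cdual.rep_eq)
      qed
      then obtain g where g: "g \<in> dual_on Y" "\<Phi> g \<noteq> g x"
        using nonrep by blast
      obtain f where f: "\<And>v. v \<in> Y \<Longrightarrow> cdual_apply f v = g v"
        by (rule cdual_extension[OF Y(1) g(1)]) blast
      have "r f = g"
        using f g(1) by (auto simp: r_def dual_on_def)
      with x[of f] f[OF \<open>x \<in> Y\<close>] g(2) show False by simp
    qed
  qed
qed

text \<open>Division by the distance \<open>d\<close> from X normalises that distance to
  \<open>1\<close>. A functional \<open>\<psi>\<close> vanishing on X takes the same value at
  \<open>z\<close> and at \<open>z - a\<close> for all \<open>a\<close> in X, so that this value is
  at most \<open>norm \<psi> * d\<close>.\<close>

lemma normalized_bidual_element: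
  fixes z :: "'a::cbanach cdual cdual"
  assumes z: "z \<notin> range canonical_embedding"
  obtains r where "\<And>x. 1 \<le> norm (r *\<^sub>C z - canonical_embedding x)"
    "\<And>\<psi>. (\<And>x. cdual_apply \<psi> (canonical_embedding x) = 0) \<Longrightarrow>
      cmod (cdual_apply \<psi> (r *\<^sub>C z)) \<le> norm \<psi>"
proof -
  let ?J = "canonical_embedding :: 'a \<Rightarrow> 'a cdual cdual"
  define d where "d = infdist z (range ?J)"
  have d: "0 < d"
    unfolding d_def using z by (intro infdist_pos_not_in_closed closed_range_canonical_embedding) auto
  define r where "r = complex_of_real (inverse d)"
  have r: "cmod r = inverse d"
    using d by (simp add: r_def norm_inverse)
  show thesis
  proof (rule that[of r])
    fix x
    have "d \<le> norm (z - ?J (of_real d *\<^sub>C x))"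
      unfolding d_def by (metis infdist_le rangeI dist_norm)
    moreover have "r *\<^sub>C z - ?J x = r *\<^sub>C (z - ?J (of_real d *\<^sub>C x))"
      using d by (simp add: r_def scaleC_diff_right canonical_embedding_scaleC scaleC_scaleC scaleC_one)
    ultimately show "1 \<le> norm (r *\<^sub>C z - ?J x)"
      using d by (simp add: norm_scaleC r field_simps)
  next
    fix \<psi> assume \<psi>: "\<And>x. cdual_apply \<psi> (?J x) = 0"
    have "cmod (cdual_apply \<psi> z) \<le> norm \<psi> * d"
    proof (cases "norm \<psi> = 0")
      case True
      then show ?thesis using norm_cdual_apply[of \<psi> z] by simp
    next
      case False
      have "cmod (cdual_apply \<psi> z) / norm \<psi> \<le> dist z a" if "a \<in> range ?J" for a
      proof -
        have "cdual_apply \<psi> (z - a) = cdual_apply \<psi> z"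
          using that \<psi> by (auto simp: cdual_diff)
        then show ?thesis
          using norm_cdual_apply[of \<psi> "z - a"] False by (simp add: dist_norm field_simps)
      qed
      then have "cmod (cdual_apply \<psi> z) / norm \<psi> \<le> d"
        unfolding d_def by (subst infdist_notempty) (auto intro!: cINF_greatest)
      then show ?thesis using False by (simp add: field_simps)
    qed
    then show "cmod (cdual_apply \<psi> (r *\<^sub>C z)) \<le> norm \<psi>"
      using d by (simp add: cdual_scaleC norm_mult r field_simps)
  qed
qed

theorem proposition6:
  fixes Y :: "'a::cbanach set"
  assumes "M_embedded TYPE('a)"
    and "csubspace Y" and "closed Y" and "\<not> reflexive_subspace Y"
  shows "\<exists>x :: nat \<Rightarrow> 'a. (\<forall>n. x n \<in> Y) \<and> spans_c0_asymptotically x"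
proof -
  obtain z :: "'a cdual cdual" where
    z: "\<And>f. (\<And>y. y \<in> Y \<Longrightarrow> cdual_apply f y = 0) \<Longrightarrow> cdual_apply z f = 0"
    and z_range: "z \<notin> range canonical_embedding"
    by (rule nonreflexive_subspace_bidual_element[OF assms(2-4)]) blast
  obtain r where r: "\<And>x. 1 \<le> norm (r *\<^sub>C z - canonical_embedding x)"
    "\<And>\<psi>. (\<And>x. cdual_apply \<psi> (canonical_embedding x) = 0) \<Longrightarrow>
      cmod (cdual_apply \<psi> (r *\<^sub>C z)) \<le> norm \<psi>"
    by (rule normalized_bidual_element[OF z_range]) blast
  have rz: "cdual_apply (r *\<^sub>C z) f = 0" if "\<And>y. y \<in> Y \<Longrightarrow> cdual_apply f y = 0" for f
    using z[OF that] by (simp add: scaleC_cdual.rep_eq)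
  \<comment> \<open>\<open>1 + \<eta> n\<close> serves as \<open>s n\<close>. A strictly decreasing
    positive null sequence bounded by \<open>1/10\<close> meets the demands of both the construction
    and the final estimate.\<close>
  define \<eta> where "\<eta> n = 1 / 10 * inverse (real (Suc n))" for n
  have \<eta>: "0 < \<eta> n" "\<eta> n \<le> 1/10" "\<eta> (Suc n) < \<eta> n" for n
    by (auto simp: \<eta>_def field_simps)
  have lim: "\<eta> \<longlonglongrightarrow> 0"
    unfolding \<eta>_def by (rule tendsto_mult_right_zero[OF LIMSEQ_inverse_real_of_nat])
  obtain x where x: "\<And>n. x n \<in> Y" "\<And>n. 1 - \<eta> n \<le> norm (x n)"
    "\<And>m \<alpha>. (\<And>n. n \<le> m \<Longrightarrow> (1 + \<eta> n) * cmod (\<alpha> n) \<le> 1) \<Longrightarrow> norm (\<Sum>n\<le>m. \<alpha> n *\<^sub>C x n) \<le> 1"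
  proof (rule M_embedded_c0_sequence[OF assms(1,2) rz r(2,1), where s = "\<lambda>n. 1 + \<eta> n" and \<eta> = \<eta>])
    show "1 \<le> 1 + \<eta> n" "1 + \<eta> (Suc n) < 1 + \<eta> n" "0 < \<eta> n" "\<eta> n \<le> 1" for n
      using \<eta>[of n] by auto
  qed blast+
  have "spans_c0_asymptotically x"
  proof (rule spans_c0_asymptoticallyI[OF x(3) _ _ _ _ _ lim x(2)])
    show "1 \<le> 1 + \<eta> n" "1 + \<eta> n \<le> 11/10" "0 \<le> \<eta> n" "\<eta> n \<le> 1/10" for n
      using \<eta>[of n] by auto
    show "(\<lambda>n. 1 + \<eta> n) \<longlonglongrightarrow> 1"
      using tendsto_add[OF tendsto_const[of 1] lim] by simp
  qed
  with x(1) show ?thesis by blast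
qed

end
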